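(* Let $\lambda\in\mathbb{R}$, $\omega>0$, and let $F_T$, $Q_T$ be the distribution and quantile functions of the generalized inverse Gaussian distribution with parameters $(\lambda,\eta,\omega)$, $\eta=1$. Let $p_m$, $p_L$, $p_R$ and $Q_B$ be as in the context. (Left problem) Let $u_0\in(0,p_m]$, $z_0=Q_B(u_0)$, $x_0=Q_T(u_0)$, and let $A$ be the solution near $z_0$ of $$\frac{dA}{dz}=2p_LK_\lambda(\omega)\frac{\omega}{2z^2}e^{-\frac\omega{2z}}e^{\frac12\omega\left(\frac1A+A\right)}A^{1-\lambda},\qquad A(z_0)=x_0.$$ Then near $z_0$, $A(z)=\sum_{n=0}^\infty a_n(z-z_0)^n$ with $$a_n=\begin{cases}x_0,&n=0\\ \frac{2p_L}nK_\lambda(\omega)\sum_{k=0}^{n-1}\sum_{j=0}^{n-k-1}(k+1)b_{k+1}d_je_{n-k-j-1},&n\ge1\end{cases},$$ $$b_n=\begin{cases}e^{-\omega/2z_0},&n=0\\ \frac\omega{2n}\sum_{k=0}^{n-1}(-1)^k\frac{k+1}{z_0^{k+2}}b_{n-k-1},&n\ge1\end{cases},\qquad c_n=\begin{cases}\frac1{a_0},&n=0\\-\frac1{a_0}\sum_{i=1}^na_ic_{n-i},&n\ge1\end{cases},$$ $$d_n=\begin{cases}e^{\omega(c_0+a_0)/2},&n=0\\ \frac\omega{2n}\sum_{i=1}^ni(c_i+a_i)d_{n-i},&n\ge1\end{cases},\qquad e_n=\begin{cases}a_0^{1-\lambda},&n=0\\ \frac1{a_0}\sum_{i=1}^n\left(\frac{(2-\lambda)i}n-1\right)a_ie_{n-i},&n\ge1\end{cases}.$$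 (Right problem) Let $u_0\in[p_m,1)$, $z_0=Q_B(u_0)$, $x_0=Q_T(u_0)$, and let $A$ be the solution near $z_0$ of $$\frac{dA}{dz}=p_R\,\omega K_\lambda(\omega)e^{\frac12\omega\left(\frac1A+A-z\right)}A^{1-\lambda},\qquad A(z_0)=x_0.$$ Then near $z_0$, $A(z)=\sum_{n=0}^\infty a_n(z-z_0)^n$ with $$a_n=\begin{cases}x_0,&n=0\\ \frac{\omega p_R}nK_\lambda(\omega)\sum_{k=0}^{n-1}d_ke_{n-k-1},&n\ge1\end{cases},$$ where $c_n$ and $e_n$ are defined from $(a_n)$ by the same formulas as in the left problem, and $$b_n=\begin{cases}\frac\omega2(c_1+a_1-1),&n=1\\ \frac\omega2(c_n+a_n),&n\ne1\end{cases},\qquad d_n=\begin{cases}e^{b_0-\omega z_0/2},&n=0\\ \frac1n\sum_{i=1}^nib_id_{n-i},&n\ge1\end{cases}.$$ (In each case $Q_T(u)=A(Q_B(u))$ for $u$ near $u_0$ with $u\le p_m$ in the left problem and $u\ge p_m$ in the right problem.)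
   Context: $K_\nu$ denotes the modified Bessel function (of the second kind, also called of the third kind). The generalized inverse Gaussian distribution with parameters $(\lambda,\eta,\omega)$, $\eta=1$, has density $f_T(x)=\frac1{2K_\lambda(\omega)}x^{\lambda-1}e^{-\frac\omega2(x^{-1}+x)}$ for $x>0$, with $F_T(x)=\int_0^xf_T(t)\,dt$ and $Q_T=F_T^{-1}:(0,1)\to(0,\infty)$. Its mode is $x_m=\frac{\lambda-1+\sqrt{(\lambda-1)^2+\omega^2}}\omega$; put $p_m=F_T(x_m)$, $p_L=e^{\frac\omega{2x_m}}p_m$, $p_R=e^{\frac\omega2x_m}(1-p_m)$. The base distribution on $(0,\infty)$ has density $f_B(x)=p_L\frac\omega{2x^2}e^{-\frac\omega{2x}}$ for $x\le x_m$ and $f_B(x)=p_R\frac\omega2e^{-\frac\omega2x}$ for $x>x_m$, and quantile function $$Q_B(u)=\begin{cases}-\frac\omega{2\ln(u/p_L)},&u\le p_m\\ x_m+\frac2\omega\ln\left(\frac{p_m-1}{u-1}\right),&u>p_m\end{cases}.$$ The function $A$ is defined by $Q_T=A\circ Q_B$; it satisfies $dA/dz=f_B(z)/f_T(A(z))$. In these recursions $e_n$ (with a subscript) denotes coefficients and $e^{(\cdot)}$ the exponential. *)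

theory Defs
  imports "HOL-Analysis.Analysis"
begin

section \<open>Modified Bessel functions of real order and positive argument\<close>

text \<open>
  The reciprocal Gamma function vanishes at the poles of Gamma, so the series is also
  the usual one for orders that are negative integers.
\<close>
definition besselI :: "real \<Rightarrow> real \<Rightarrow> real" where
  "besselI \<nu> x = (\<Sum>k. rGamma (\<nu> + real k + 1) / fact k * (x / 2) powr (2 * real k + \<nu>))"

text \<open>At integer order the quotient is 0/0 and the function is its limit in the order.\<close>
definition besselK :: "real \<Rightarrow> real \<Rightarrow> real" where
  "besselK \<nu> x =
     (let q = (\<lambda>\<mu>. pi / 2 * (besselI (- \<mu>) x - besselI \<mu> x) / sin (\<mu> * pi))
      in if \<nu> \<in> \<int> then Lim (at \<nu>) q else q \<nu>)"

section \<open>The generalized inverse Gaussian distribution with unit scale\<close>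

text \<open>The density is meant for positive arguments only.\<close>
definition gig_pdf :: "real \<Rightarrow> real \<Rightarrow> real \<Rightarrow> real" where
  "gig_pdf l \<omega> x = 1 / (2 * besselK l \<omega>) * x powr (l - 1) * exp (- (\<omega> / 2) * (1 / x + x))"

definition gig_cdf :: "real \<Rightarrow> real \<Rightarrow> real \<Rightarrow> real" where
  "gig_cdf l \<omega> x = (LBINT t:{0<..x}. gig_pdf l \<omega> t)"

definition gig_quantile :: "real \<Rightarrow> real \<Rightarrow> real \<Rightarrow> real" where
  "gig_quantile l \<omega> = the_inv_into {0<..} (gig_cdf l \<omega>)"

definition gig_mode :: "real \<Rightarrow> real \<Rightarrow> real" where
  "gig_mode l \<omega> = (l - 1 + sqrt ((l - 1)\<^sup>2 + \<omega>\<^sup>2)) / \<omega>"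

section \<open>The base distribution\<close>

definition p_mode :: "real \<Rightarrow> real \<Rightarrow> real" where
  "p_mode l \<omega> = gig_cdf l \<omega> (gig_mode l \<omega>)"

definition p_left :: "real \<Rightarrow> real \<Rightarrow> real" where
  "p_left l \<omega> = exp (\<omega> / (2 * gig_mode l \<omega>)) * p_mode l \<omega>"

definition p_right :: "real \<Rightarrow> real \<Rightarrow> real" where
  "p_right l \<omega> = exp (\<omega> / 2 * gig_mode l \<omega>) * (1 - p_mode l \<omega>)"

definition base_quantile :: "real \<Rightarrow> real \<Rightarrow> real \<Rightarrow> real" where
  "base_quantile l \<omega> u =
     (if u \<le> p_mode l \<omega> then - (\<omega> / (2 * ln (u / p_left l \<omega>)))
      else gig_mode l \<omega> + 2 / \<omega> * ln ((p_mode l \<omega> - 1) / (u - 1)))"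

section \<open>Local solutions of a scalar initial value problem\<close>

definition solves_ivp_near ::
    "(real \<Rightarrow> real \<Rightarrow> real) \<Rightarrow> real \<Rightarrow> real \<Rightarrow> (real \<Rightarrow> real) \<Rightarrow> bool" where
  "solves_ivp_near G z0 x0 A \<longleftrightarrow>
     A z0 = x0 \<and> (\<forall>\<^sub>F z in nhds z0. (A has_real_derivative G z (A z)) (at z))"

definition left_rhs :: "real \<Rightarrow> real \<Rightarrow> real \<Rightarrow> real \<Rightarrow> real" where
  "left_rhs l \<omega> z y =
     2 * p_left l \<omega> * besselK l \<omega> * (\<omega> / (2 * z\<^sup>2)) * exp (- (\<omega> / (2 * z)))
       * exp (1 / 2 * \<omega> * (1 / y + y)) * y powr (1 - l)"

definition right_rhs :: "real \<Rightarrow> real \<Rightarrow> real \<Rightarrow> real \<Rightarrow> real" where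
  "right_rhs l \<omega> z y =
     p_right l \<omega> * \<omega> * besselK l \<omega> * exp (1 / 2 * \<omega> * (1 / y + y - z)) * y powr (1 - l)"

section \<open>Coefficient recursions\<close>

function left_b :: "real \<Rightarrow> real \<Rightarrow> nat \<Rightarrow> real" where
  "left_b \<omega> z0 n =
     (if n = 0 then exp (- (\<omega> / (2 * z0)))
      else \<omega> / (2 * real n) *
        (\<Sum>k<n. (-1) ^ k * (real (k + 1) / z0 ^ (k + 2)) * left_b \<omega> z0 (n - k - 1)))"
  by pat_completeness auto
termination
  by (relation "Wellfounded.measure (\<lambda>(_, _, n). n)") auto

function left_a left_c left_d left_e :: "real \<Rightarrow> real \<Rightarrow> real \<Rightarrow> real \<Rightarrow> nat \<Rightarrow> real" where
  "left_a l \<omega> z0 x0 n =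
     (if n = 0 then x0
      else 2 * p_left l \<omega> / real n * besselK l \<omega> *
        (\<Sum>k<n. \<Sum>j<n - k. real (k + 1) * left_b \<omega> z0 (k + 1) * left_d l \<omega> z0 x0 j
            * left_e l \<omega> z0 x0 (n - k - j - 1)))"
| "left_c l \<omega> z0 x0 n =
     (if n = 0 then 1 / left_a l \<omega> z0 x0 0
      else - (1 / left_a l \<omega> z0 x0 0) *
        (\<Sum>i = 1..n. left_a l \<omega> z0 x0 i * left_c l \<omega> z0 x0 (n - i)))"
| "left_d l \<omega> z0 x0 n =
     (if n = 0 then exp (\<omega> * (left_c l \<omega> z0 x0 0 + left_a l \<omega> z0 x0 0) / 2)
      else \<omega> / (2 * real n) *
        (\<Sum>i = 1..n. real i * (left_c l \<omega> z0 x0 i + left_a l \<omega> z0 x0 i)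
            * left_d l \<omega> z0 x0 (n - i)))"
| "left_e l \<omega> z0 x0 n =
     (if n = 0 then left_a l \<omega> z0 x0 0 powr (1 - l)
      else 1 / left_a l \<omega> z0 x0 0 *
        (\<Sum>i = 1..n. ((2 - l) * real i / real n - 1) * left_a l \<omega> z0 x0 i
            * left_e l \<omega> z0 x0 (n - i)))"
  by pat_completeness auto
termination
  by (relation "Wellfounded.measure (\<lambda>s. case s of
         Inl (Inl (_, _, _, _, n)) \<Rightarrow> 4 * n
       | Inl (Inr (_, _, _, _, n)) \<Rightarrow> 4 * n + 1
       | Inr (Inl (_, _, _, _, n)) \<Rightarrow> 4 * n + 2
       | Inr (Inr (_, _, _, _, n)) \<Rightarrow> 4 * n + 2)") auto

function right_a right_b right_c right_d right_e ::
    "real \<Rightarrow> real \<Rightarrow> real \<Rightarrow> real \<Rightarrow> nat \<Rightarrow> real" where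
  "right_a l \<omega> z0 x0 n =
     (if n = 0 then x0
      else \<omega> * p_right l \<omega> / real n * besselK l \<omega> *
        (\<Sum>k<n. right_d l \<omega> z0 x0 k * right_e l \<omega> z0 x0 (n - k - 1)))"
| "right_b l \<omega> z0 x0 n =
     (if n = 1 then \<omega> / 2 * (right_c l \<omega> z0 x0 1 + right_a l \<omega> z0 x0 1 - 1)
      else \<omega> / 2 * (right_c l \<omega> z0 x0 n + right_a l \<omega> z0 x0 n))"
| "right_c l \<omega> z0 x0 n =
     (if n = 0 then 1 / right_a l \<omega> z0 x0 0
      else - (1 / right_a l \<omega> z0 x0 0) *
        (\<Sum>i = 1..n. right_a l \<omega> z0 x0 i * right_c l \<omega> z0 x0 (n - i)))"
| "right_d l \<omega> z0 x0 n =
     (if n = 0 then exp (right_b l \<omega> z0 x0 0 - \<omega> * z0 / 2)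
      else 1 / real n *
        (\<Sum>i = 1..n. real i * right_b l \<omega> z0 x0 i * right_d l \<omega> z0 x0 (n - i)))"
| "right_e l \<omega> z0 x0 n =
     (if n = 0 then right_a l \<omega> z0 x0 0 powr (1 - l)
      else 1 / right_a l \<omega> z0 x0 0 *
        (\<Sum>i = 1..n. ((2 - l) * real i / real n - 1) * right_a l \<omega> z0 x0 i
            * right_e l \<omega> z0 x0 (n - i)))"
  by pat_completeness auto
termination
  by (relation "Wellfounded.measure (\<lambda>s. case s of
         Inl (Inl (_, _, _, _, n)) \<Rightarrow> 4 * n
       | Inl (Inr (_, _, _, _, n)) \<Rightarrow> 4 * n + 2
       | Inr (Inl (_, _, _, _, n)) \<Rightarrow> 4 * n + 1
       | Inr (Inr (Inl (_, _, _, _, n))) \<Rightarrow> 4 * n + 3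
       | Inr (Inr (Inr (_, _, _, _, n))) \<Rightarrow> 4 * n + 3)") auto

text \<open>The recursion equations loop as rewrite rules.\<close>
declare left_b.simps [simp del]
declare left_a.simps [simp del] left_c.simps [simp del] left_d.simps [simp del]
  left_e.simps [simp del]
declare right_a.simps [simp del] right_b.simps [simp del] right_c.simps [simp del]
  right_d.simps [simp del] right_e.simps [simp del]

end

(*
  The equations are separable: with F the distribution function and B the base distribution function
  (p_L e^(-w/2z) on the left, 1 - p_R e^(-wz/2) on the right) they say F (A z) = B z, so A = Q o B is
  the only solution. Since F extends holomorphically with non-vanishing derivative, A extends to a
  holomorphic function, and comparing coefficients in B' = (w/2z^2) B, A C = 1,
  D' = (w/2) (C + A)' D, A E' = (1 - l) A' E and in the equation itself gives the recursions.

  That F maps onto (0,1) needs K_l(w) to be the normalizing integral, although K is defined by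
  ascending series. The integrals F_n(y) of s^(n-1) e^(-s-y/s) and the combinations H_n of the
  ascending series both satisfy X_n' = - X_(n-1) and X_(-n) = y^(-n) X_n, and they agree at y = 0
  for 0 < n < 1; a Gronwall argument starting at the singular point y = 0 identifies them there, the
  two rules carry this to all non-integral n, and integral orders follow by continuity in n.
*)
theory Submission
  imports Defs "HOL-Complex_Analysis.Complex_Analysis"
begin

section \<open>The integral representation of the modified Bessel function\<close>

text \<open>In the variable y = x^2 / 4, with the factor (x / 2) powr \<nu> absorbed, Bessel's
  second-order equation becomes one derivative rule and one symmetry, free of constants that depend
  on the order. The comparison at y = 0 needs positive orders, where both sides tend to Gamma. The
  derivative rule lowers the order to \<nu> - 1 < 0, and the symmetry turns this into 1 - \<nu>; so
  the pair \<nu>, 1 - \<nu> closes, and both are positive exactly for 0 < \<nu> < 1.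

  K cancels from the local calculus, since it stands both in the density and in the equation. Its
  exact value matters for the range of F, that is, for Q_T to be defined on all of (0,1).

  Convergence comes from the holomorphic extension; the recursions only compute its Taylor
  coefficients, which are complex at first and are recognised as the real sequences by induction.

  At u0 = p_m every neighbourhood of z0 contains points on both sides of the mode. Each equation
  keeps its own formula on both sides, so A is analytic across z0, but its link with Q_B is
  one-sided.\<close>

definition exp_recip_integral :: "real \<Rightarrow> real \<Rightarrow> real" where
  "exp_recip_integral \<nu> y = (LBINT s:{0<..}. s powr (\<nu> - 1) * exp (- s - y / s))"

lemma Gamma_set_integral:
  assumes "\<nu> > (0::real)"
  shows "set_integrable lborel {0<..} (\<lambda>s. s powr (\<nu> - 1) * exp (- s))"
    and "(LBINT s:{0<..}. s powr (\<nu> - 1) * exp (- s)) = Gamma \<nu>"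
proof -
  have "(\<integral>\<^sup>+t. ennreal (indicator {0<..} t *\<^sub>R (t powr (\<nu> - 1) * exp (- t))) \<partial>lborel)
      = (\<integral>\<^sup>+t. ennreal (indicator {0..} t * t powr (\<nu> - 1) / exp t) \<partial>lborel)"
    \<comment> \<open>The two half-lines differ only in the point 0, where \<open>powr\<close> takes
      the value 0.\<close>
    by (intro nn_integral_cong arg_cong[where f = ennreal])
       (auto simp: indicator_def exp_minus field_simps order.order_iff_strict)
  also have "\<dots> = ennreal (Gamma \<nu>)"
    using Gamma_conv_nn_integral_real[OF assms] by simp
  finally have "integrable lborel (\<lambda>t. indicator {0<..} t *\<^sub>R (t powr (\<nu> - 1) * exp (- t))) \<and>
      (\<integral>t. indicator {0<..} t *\<^sub>R (t powr (\<nu> - 1) * exp (- t)) \<partial>lborel) = Gamma \<nu>"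
    using assms by (subst (asm) nn_integral_eq_integrable) (auto intro: Gamma_real_nonneg)
  then show "set_integrable lborel {0<..} (\<lambda>s. s powr (\<nu> - 1) * exp (- s))"
    and "(LBINT s:{0<..}. s powr (\<nu> - 1) * exp (- s)) = Gamma \<nu>"
    by (simp_all add: set_integrable_def set_lebesgue_integral_def)
qed

text \<open>A single term of the exponential series is a lower bound for exp t. With t = y / s this
  trades exp (- y / s) for any power of s.\<close>

lemma exp_neg_le_fact_powr:
  assumes "t > (0::real)"
  shows "exp (- t) \<le> fact m / t ^ m"
proof -
  have "t ^ m / fact m \<le> (\<Sum>n\<in>{m}. t ^ n /\<^sub>R fact n)"
    by (simp add: divide_inverse)
  also have "\<dots> \<le> exp t"
    unfolding exp_def by (rule sum_le_suminf[OF summable_exp_generic]) (use assms in auto)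
  finally show ?thesis using assms by (simp add: exp_minus field_simps)
qed

text \<open>For \<nu> \<le> 0 the power alone is not integrable at 0. The factor exp (- y / s) is
  exchanged for s^m with \<nu> + m > 0, which leaves a Gamma integrand as dominating
  function.\<close>

lemma exp_recip_integrable:
  fixes y \<nu> :: real
  assumes "y > 0"
  shows "set_integrable lborel {0<..} (\<lambda>s. s powr (\<nu> - 1) * exp (- s - y / s))"
proof -
  obtain m :: nat where "- \<nu> < real m"
    using reals_Archimedean2 by blast
  then have m: "\<nu> + real m > 0" by linarith
  have "set_integrable lborel {0<..} (\<lambda>s. fact m / y ^ m * (s powr (\<nu> + m - 1) * exp (- s)))"
    by (rule set_integrable_mult_right) (rule Gamma_set_integral[OF m])
  then show ?thesis
  proof (rule set_integrable_bound)
    show "set_borel_measurable lborel {0<..} (\<lambda>s. s powr (\<nu> - 1) * exp (- s - y / s))"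
      unfolding set_borel_measurable_def by measurable
    show "AE s in lborel. s \<in> {0<..} \<longrightarrow> norm (s powr (\<nu> - 1) * exp (- s - y / s))
        \<le> norm (fact m / y ^ m * (s powr (\<nu> + m - 1) * exp (- s)))"
    proof (intro AE_I2 impI)
      fix s :: real assume "s \<in> {0<..}"
      then have s: "s > 0" by simp
      have "exp (- (y / s)) \<le> fact m / (y / s) ^ m"
        using exp_neg_le_fact_powr[of "y / s" m] s assms by simp
      also have "\<dots> = fact m / y ^ m * s powr m"
        using s by (simp add: powr_realpow power_divide)
      finally have "s powr (\<nu> - 1) * exp (- s) * exp (- (y / s))
          \<le> s powr (\<nu> - 1) * exp (- s) * (fact m / y ^ m * s powr m)"
        by (intro mult_left_mono) auto
      also have "\<dots> = fact m / y ^ m * (s powr (\<nu> + m - 1) * exp (- s))"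
        using s by (simp add: powr_add powr_diff mult_ac)
      finally show "norm (s powr (\<nu> - 1) * exp (- s - y / s))
        \<le> norm (fact m / y ^ m * (s powr (\<nu> + m - 1) * exp (- s)))"
        using assms s by (simp add: abs_mult mult.assoc flip: exp_add)
    qed
  qed
qed

lemma exp_recip_integral_pos:
  assumes "y > 0" 
  shows "exp_recip_integral \<nu> y > 0"
proof -
  have "exp_recip_integral \<nu> y \<ge> 0"
    unfolding exp_recip_integral_def set_lebesgue_integral_def
    by (intro integral_nonneg_AE) (auto simp: indicator_def)
  moreover have "exp_recip_integral \<nu> y \<noteq> 0"
  proof
    assume "exp_recip_integral \<nu> y = 0"
    then have "AE s in lborel. indicator {0<..} s *\<^sub>R (s powr (\<nu> - 1) * exp (- s - y / s)) = 0"
      using exp_recip_integrable[OF assms, of \<nu>]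
      unfolding exp_recip_integral_def set_lebesgue_integral_def set_integrable_def
      by (subst (asm) integral_nonneg_eq_0_iff_AE) (auto simp: indicator_def)
    then have "AE s in lborel. s \<notin> {0<..(1::real)}"
      by eventually_elim (auto simp: indicator_def split: if_splits)
    then have "{0<..(1::real)} \<in> null_sets lborel"
      by (subst (asm) AE_iff_null_sets[symmetric]) auto
    then show False by (simp add: null_sets_def)
  qed
  ultimately show ?thesis by linarith
qed

text \<open>The substitution s = y / t swaps the two terms s and y / s of the exponent and reverses
  the sign of the order.\<close>

lemma exp_recip_integral_symmetric:
  assumes "y > 0"
  shows "exp_recip_integral (- \<nu>) y = y powr (- \<nu>) * exp_recip_integral \<nu> y"
proof -
  let ?f = "\<lambda>s. s powr (\<nu> - 1) * exp (- s - y / s)"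
  let ?h = "\<lambda>s. s powr (- \<nu> - 1) * exp (- s - y / s)"
  let ?g = "\<lambda>t::real. y / t"
  \<comment> \<open>The change of variables is carried out for the Henstock-Kurzweil integral; this
    is the passage to it from Lebesgue integrability.\<close>
  have abs: "f absolutely_integrable_on {0<..}"
    if "set_integrable lborel {0<..} f" for f :: "real \<Rightarrow> real"
    using that unfolding set_integrable_def
    by (metis borel_measurable_integrable integrable_completion)
  have img: "?g ` {0<..} = {0<..}"
  proof (intro equalityI subsetI)
    fix s :: real assume "s \<in> {0<..}"
    then show "s \<in> ?g ` {0<..}" using assms by (intro image_eqI[of _ _ "y / s"]) auto
  qed (use assms in auto)
  have "(\<lambda>t. \<bar>- y / t\<^sup>2\<bar> * ?f (?g t)) absolutely_integrable_on {0<..} \<and>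
      integral {0<..} (\<lambda>t. \<bar>- y / t\<^sup>2\<bar> * ?f (?g t)) = integral {0<..} ?f
    \<longleftrightarrow> ?f absolutely_integrable_on (?g ` {0<..}) \<and> integral (?g ` {0<..}) ?f = integral {0<..} ?f"
    using assms
    by (intro has_absolute_integral_change_of_variables_1')
       (auto intro!: derivative_eq_intros inj_onI simp: power2_eq_square)
  then have "integral {0<..} (\<lambda>t. \<bar>- y / t\<^sup>2\<bar> * ?f (?g t)) = integral {0<..} ?f"
    using abs[OF exp_recip_integrable[OF assms, of \<nu>]] by (simp add: img)
  moreover have "integral {0<..} (\<lambda>t. \<bar>- y / t\<^sup>2\<bar> * ?f (?g t)) = integral {0<..} (\<lambda>t. y powr \<nu> * ?h t)"
  proof (rule integral_cong)
    fix t :: real assume "t \<in> {0<..}"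
    then have t: "t > 0" by simp
    show "\<bar>- y / t\<^sup>2\<bar> * ?f (?g t) = y powr \<nu> * ?h t"
    proof -
      have "(y / t) powr (\<nu> - 1) = y powr \<nu> / y * (t / t powr \<nu>)"
        using t assms by (simp add: powr_divide powr_diff)
      moreover have "t powr (- \<nu> - 1) = 1 / (t * t powr \<nu>)"
        using t by (simp add: powr_diff powr_minus_divide)
      moreover have "exp (- (y / t) - t) = exp (- t - y / t)" by (simp add: algebra_simps)
      ultimately show ?thesis using t assms by (simp add: power2_eq_square)
    qed
  qed
  ultimately have "integral {0<..} ?f = y powr \<nu> * integral {0<..} ?h" by simp
  then have "exp_recip_integral \<nu> y = y powr \<nu> * exp_recip_integral (- \<nu>) y"
    unfolding exp_recip_integral_def
    by (simp add: set_borel_integral_eq_integral(2)[OF exp_recip_integrable[OF assms]])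
  then show ?thesis using assms by (simp add: powr_minus)
qed

text \<open>Differentiation under the integral sign with an explicit remainder: the quadratic Taylor
  remainder of exp (- h / s) costs a factor exp (\<bar>h\<bar> / s), which for \<bar>h\<bar> \<le> y
  / 2 is paid by half of the decay exp (- y / s). The remaining 1 / s^2 lowers the order by two, so
  the error is at most h^2 times the integral of order \<nu> - 2 at y / 2.\<close>

lemma exp_recip_integral_has_derivative:
  assumes y: "y > 0"
  shows "((\<lambda>y. exp_recip_integral \<nu> y) has_real_derivative - exp_recip_integral (\<nu> - 1) y) (at y)"
proof -
  let ?f = "\<lambda>\<nu> y s. s powr (\<nu> - 1) * exp (- s - y / s)"
  let ?M = "exp_recip_integral (\<nu> - 2) (y / 2)"
  have taylor: "\<bar>exp u - 1 - u\<bar> \<le> u\<^sup>2 * exp \<bar>u\<bar>" for u :: real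
  proof -
    obtain t where t: "\<bar>t\<bar> \<le> \<bar>u\<bar>" "exp u = (\<Sum>m<2. u ^ m / fact m) + exp t / fact 2 * u ^ 2"
      using Maclaurin_exp_le[of u 2] by blast
    then have "\<bar>exp u - 1 - u\<bar> = exp t / 2 * u\<^sup>2" by (simp add: numeral_2_eq_2 abs_mult)
    also have "\<dots> \<le> exp \<bar>u\<bar> * u\<^sup>2"
    proof (rule mult_right_mono)
      have "exp t \<le> exp \<bar>u\<bar>" using t(1) by simp
      then show "exp t / 2 \<le> exp \<bar>u\<bar>" using exp_ge_zero[of t] by linarith
    qed simp
    finally show ?thesis by (simp add: mult.commute)
  qed
  have bound: "\<bar>exp_recip_integral \<nu> (y + h) - exp_recip_integral \<nu> y + h * exp_recip_integral (\<nu> - 1) y\<bar> \<le> h\<^sup>2 * ?M"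
    if h: "\<bar>h\<bar> \<le> y / 2" for h
  proof -
    have int: "set_integrable lborel {0<..} (?f \<nu> (y + h))" "set_integrable lborel {0<..} (?f \<nu> y)"
        "set_integrable lborel {0<..} (?f (\<nu> - 1) y)" "set_integrable lborel {0<..} (?f (\<nu> - 2) (y / 2))"
      by (rule exp_recip_integrable, use h y in linarith)+
    have int2: "set_integrable lborel {0<..} (\<lambda>s. ?f \<nu> (y + h) s - ?f \<nu> y s + h * ?f (\<nu> - 1) y s)"
      using int by (intro set_integral_add set_integral_diff set_integrable_mult_right)
    have eq: "exp_recip_integral \<nu> (y + h) - exp_recip_integral \<nu> y + h * exp_recip_integral (\<nu> - 1) y
        = (LBINT s:{0<..}. ?f \<nu> (y + h) s - ?f \<nu> y s + h * ?f (\<nu> - 1) y s)"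
      unfolding exp_recip_integral_def
      by (subst set_integral_add(2), (intro set_integral_diff set_integrable_mult_right int)+,
          subst set_integral_diff(2), (rule int)+, subst set_integral_mult_right, rule refl)
    have "\<bar>exp_recip_integral \<nu> (y + h) - exp_recip_integral \<nu> y + h * exp_recip_integral (\<nu> - 1) y\<bar>
        \<le> (LBINT s:{0<..}. \<bar>?f \<nu> (y + h) s - ?f \<nu> y s + h * ?f (\<nu> - 1) y s\<bar>)"
      unfolding eq using set_integral_norm_bound[OF int2] by (simp only: real_norm_def)
    also have "\<dots> \<le> (LBINT s:{0<..}. h\<^sup>2 * ?f (\<nu> - 2) (y / 2) s)"
    proof (rule set_integral_mono)
      show "set_integrable lborel {0<..} (\<lambda>s. \<bar>?f \<nu> (y + h) s - ?f \<nu> y s + h * ?f (\<nu> - 1) y s\<bar>)"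
        using int2 by (rule set_integrable_abs)
      show "set_integrable lborel {0<..} (\<lambda>s. h\<^sup>2 * ?f (\<nu> - 2) (y / 2) s)"
        using int(4) by (rule set_integrable_mult_right)
      fix s :: real assume "s \<in> {0<..}"
      then have s: "s > 0" by simp
      have "\<nu> - 2 - 1 = (\<nu> - 1) - 2" by simp
      then have pw: "s powr (\<nu> - 2 - 1) = s powr (\<nu> - 1) / s\<^sup>2"
        using s by (simp only: powr_diff powr_numeral)
      define c where "c = s powr (\<nu> - 1) * exp (- s - y / s)"
      have "?f \<nu> (y + h) s - ?f \<nu> y s + h * ?f (\<nu> - 1) y s = c * (exp (- h / s) - 1 - (- h / s))"
      proof -
        have "?f \<nu> (y + h) s = c * exp (- h / s)"
          unfolding c_def by (simp add: exp_add[symmetric] add_divide_distrib)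
        moreover have "?f (\<nu> - 1) y s = c / s"
          using s unfolding c_def by (simp add: powr_diff power2_eq_square)
        ultimately show ?thesis by (simp add: c_def algebra_simps)
      qed
      then have "\<bar>?f \<nu> (y + h) s - ?f \<nu> y s + h * ?f (\<nu> - 1) y s\<bar> = c * \<bar>exp (- h / s) - 1 - (- h / s)\<bar>"
        by (simp add: abs_mult c_def)
      also have "\<dots> \<le> c * ((- h / s)\<^sup>2 * exp \<bar>- h / s\<bar>)"
        by (intro mult_left_mono taylor) (simp add: c_def)
      also have "\<dots> = h\<^sup>2 * s powr (\<nu> - 2 - 1) * exp (- s - y / s + \<bar>h\<bar> / s)"
      proof -
        have "exp (- s - y / s + \<bar>h\<bar> / s) = exp (- s - y / s) * exp \<bar>- h / s\<bar>"
          using s by (simp add: exp_add)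
        then show ?thesis by (simp only: pw c_def power_divide power2_minus times_divide_eq_left times_divide_eq_right mult.assoc mult.commute mult.left_commute)
      qed
      also have "\<dots>
          \<le> h\<^sup>2 * s powr (\<nu> - 2 - 1) * exp (- s - y / 2 / s)"
      proof (intro mult_left_mono)
        have "\<bar>h\<bar> / s \<le> (y / 2) / s" using h s by (intro divide_right_mono) auto
        moreover have "y / s = y / 2 / s + y / 2 / s" by simp
        ultimately show "exp (- s - y / s + \<bar>h\<bar> / s) \<le> exp (- s - y / 2 / s)" by simp
      qed auto
      finally show "\<bar>?f \<nu> (y + h) s - ?f \<nu> y s + h * ?f (\<nu> - 1) y s\<bar> \<le> h\<^sup>2 * ?f (\<nu> - 2) (y / 2) s"
        by (simp add: mult.assoc)
    qed
    also have "\<dots> = h\<^sup>2 * ?M"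
      unfolding exp_recip_integral_def by (rule set_integral_mult_right)
    finally show ?thesis .
  qed
  show ?thesis
    unfolding DERIV_def
  proof (rule LIM_zero_cancel, rule Lim_null_comparison)
    show "\<forall>\<^sub>F h in at 0. norm ((exp_recip_integral \<nu> (y + h) - exp_recip_integral \<nu> y) / h - - exp_recip_integral (\<nu> - 1) y) \<le> \<bar>h\<bar> * ?M"
      unfolding eventually_at
    proof (intro exI[of _ "y / 2"] conjI ballI impI)
      fix h :: real assume "h \<noteq> 0 \<and> dist h 0 < y / 2"
      then have h: "h \<noteq> 0" "\<bar>h\<bar> \<le> y / 2" by auto
      define d where "d = exp_recip_integral \<nu> (y + h) - exp_recip_integral \<nu> y"
      define e where "e = exp_recip_integral (\<nu> - 1) y"
      define M where "M = ?M"
      have "\<bar>d + h * e\<bar> \<le> h\<^sup>2 * M"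
        using bound[OF h(2)] by (simp only: d_def e_def M_def)
      moreover have "\<bar>d / h - - e\<bar> = \<bar>d + h * e\<bar> / \<bar>h\<bar>"
        using h(1) by (simp add: abs_divide[symmetric] add_divide_distrib)
      moreover have "h\<^sup>2 * M / \<bar>h\<bar> = \<bar>h\<bar> * M"
        using h(1) by (simp add: power2_eq_square divide_simps)
      ultimately have "\<bar>d / h - - e\<bar> \<le> \<bar>h\<bar> * M"
        using divide_right_mono[of "\<bar>d + h * e\<bar>" "h\<^sup>2 * M" "\<bar>h\<bar>"] by simp
      then show "norm ((exp_recip_integral \<nu> (y + h) - exp_recip_integral \<nu> y) / h - - exp_recip_integral (\<nu> - 1) y) \<le> \<bar>h\<bar> * ?M"
        by (simp only: real_norm_def d_def e_def M_def)
    qed (use y in auto)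
    show "((\<lambda>h. \<bar>h\<bar> * ?M) \<longlongrightarrow> 0) (at 0)"
      by (rule tendsto_eq_rhs, (rule tendsto_intros)+, simp)
  qed
qed

text \<open>Since exp (- y / s) \<le> 1, the Gamma integrand dominates for all y > 0. Dominated
  convergence is applied along sequences, to which limits at a point reduce.\<close>

lemma exp_recip_integral_tendsto_Gamma:
  assumes "\<nu> > 0"
  shows "((\<lambda>y. exp_recip_integral \<nu> y) \<longlongrightarrow> Gamma \<nu>) (at_right 0)"
  unfolding tendsto_at_iff_sequentially
proof (intro allI impI)
  fix X :: "nat \<Rightarrow> real"
  assume X: "\<forall>i. X i \<in> {0<..} - {0}" "X \<longlonglongrightarrow> 0"
  let ?g = "\<lambda>s. s powr (\<nu> - 1) * exp (- s)"
  have "(\<lambda>i. LBINT s. indicator {0<..} s *\<^sub>R (s powr (\<nu> - 1) * exp (- s - X i / s)))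
      \<longlonglongrightarrow> (LBINT s. indicator {0<..} s *\<^sub>R ?g s)"
  proof (rule integral_dominated_convergence)
    show "integrable lborel (\<lambda>s. indicator {0<..} s *\<^sub>R ?g s)"
      using Gamma_set_integral(1)[OF assms] by (simp add: set_integrable_def)
    show "AE s in lborel. (\<lambda>i. indicator {0<..} s *\<^sub>R (s powr (\<nu> - 1) * exp (- s - X i / s)))
        \<longlonglongrightarrow> indicator {0<..} s *\<^sub>R ?g s"
      by (intro AE_I2) (auto intro!: tendsto_eq_intros X(2) simp: indicator_def)
    show "AE s in lborel. norm (indicator {0<..} s *\<^sub>R (s powr (\<nu> - 1) * exp (- s - X i / s)))
        \<le> indicator {0<..} s *\<^sub>R ?g s" for i
      using X(1)[rule_format, of i]
      by (intro AE_I2) (auto intro!: mult_left_mono simp: indicator_def)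
  qed auto
  then show "((\<lambda>y. exp_recip_integral \<nu> y) \<circ> X) \<longlonglongrightarrow> Gamma \<nu>"
    using Gamma_set_integral(2)[OF assms]
    by (simp add: exp_recip_integral_def set_lebesgue_integral_def o_def)
qed

text \<open>For orders within distance 1 of \<nu>, the power of s is at most the larger extreme
  power if s \<ge> 1 and the smaller one if s < 1; the sum of the two integrands dominates both
  cases.\<close>

lemma exp_recip_integral_continuous_order:
  assumes y: "y > 0"
  shows "((\<lambda>\<mu>. exp_recip_integral \<mu> y) \<longlongrightarrow> exp_recip_integral \<nu> y) (at \<nu>)"
proof -
  let ?f = "\<lambda>\<nu> s. s powr (\<nu> - 1) * exp (- s - y / s)"
  have "((\<lambda>\<mu>. exp_recip_integral \<mu> y) \<longlongrightarrow> exp_recip_integral \<nu> y) (at \<nu> within {\<nu> - 1<..<\<nu> + 1})"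
    unfolding tendsto_at_iff_sequentially
  proof (intro allI impI)
    fix X :: "nat \<Rightarrow> real"
    assume X: "\<forall>i. X i \<in> {\<nu> - 1<..<\<nu> + 1} - {\<nu>}" "X \<longlonglongrightarrow> \<nu>"
    have "(\<lambda>i. LBINT s. indicator {0<..} s *\<^sub>R ?f (X i) s) \<longlonglongrightarrow> (LBINT s. indicator {0<..} s *\<^sub>R ?f \<nu> s)"
    proof (rule integral_dominated_convergence)
      show "integrable lborel (\<lambda>s. indicator {0<..} s *\<^sub>R (?f (\<nu> - 1) s + ?f (\<nu> + 1) s))"
        using set_integral_add(1)[OF exp_recip_integrable[OF y, of "\<nu> - 1"] exp_recip_integrable[OF y, of "\<nu> + 1"]]
        by (simp add: set_integrable_def)
      show "AE s in lborel. (\<lambda>i. indicator {0<..} s *\<^sub>R ?f (X i) s) \<longlonglongrightarrow> indicator {0<..} s *\<^sub>R ?f \<nu> s"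
        by (intro AE_I2) (auto intro!: tendsto_intros X(2) simp: indicator_def)
      show "AE s in lborel. norm (indicator {0<..} s *\<^sub>R ?f (X i) s)
          \<le> indicator {0<..} s *\<^sub>R (?f (\<nu> - 1) s + ?f (\<nu> + 1) s)" for i
      proof (intro AE_I2)
        fix s :: real
        have Xi: "\<nu> - 1 < X i" "X i < \<nu> + 1" using X(1)[rule_format, of i] by auto
        have "s powr (X i - 1) \<le> s powr (\<nu> - 1 - 1) + s powr (\<nu> + 1 - 1)" if "s > 0"
        proof (cases "s \<ge> 1")
          case True
          then have "s powr (X i - 1) \<le> s powr (\<nu> + 1 - 1)" using Xi by (intro powr_mono) auto
          then show ?thesis using powr_ge_zero[of s "\<nu> - 1 - 1"] by linarith
        next
          case False
          then have "s powr (X i - 1) \<le> s powr (\<nu> - 1 - 1)" using Xi that by (intro powr_mono') auto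
          then show ?thesis using powr_ge_zero[of s "\<nu> + 1 - 1"] by linarith
        qed
        then show "norm (indicator {0<..} s *\<^sub>R ?f (X i) s)
          \<le> indicator {0<..} s *\<^sub>R (?f (\<nu> - 1) s + ?f (\<nu> + 1) s)"
          by (auto simp: indicator_def distrib_right[symmetric] intro!: mult_right_mono)
      qed
    qed auto
    then show "((\<lambda>\<mu>. exp_recip_integral \<mu> y) \<circ> X) \<longlonglongrightarrow> exp_recip_integral \<nu> y"
      by (simp add: exp_recip_integral_def set_lebesgue_integral_def o_def)
  qed
  then show ?thesis by (subst (asm) at_within_open) auto
qed

section \<open>The ascending series in y = x^2 / 4 (Bessel-Clifford functions)\<close>

definition bessel_series :: "real \<Rightarrow> real \<Rightarrow> real" where
  "bessel_series \<mu> y = (\<Sum>k. rGamma (\<mu> + real k + 1) / fact k * y ^ k)"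

lemma summable_bessel_series:
  fixes \<mu> y :: real
  shows "summable (\<lambda>k. rGamma (\<mu> + real k + 1) / fact k * y ^ k)"
proof -
  \<comment> \<open>From this index on \<mu> + k + 1 is at least 2 \<bar>y\<bar>, which gives the
    ratio 1 / 2.\<close>
  obtain N :: nat where N: "real N > \<bar>\<mu>\<bar> + 2 * \<bar>y\<bar>"
    using reals_Archimedean2 by blast
  show ?thesis
  proof (rule summable_ratio_test[of "1 / 2" N])
    fix k assume k: "k \<ge> N"
    \<comment> \<open>Consecutive terms are both written as multiples of \<open>c\<close>. Their
      quotient is avoided because reciprocal Gamma values can vanish when \<mu> is a negative
      integer.\<close>
    define c where "c = rGamma (\<mu> + real (Suc k) + 1) * y ^ k / fact k"
    have "rGamma (\<mu> + real k + 1) = (\<mu> + real k + 1) * rGamma (\<mu> + real (Suc k) + 1)"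
      using rGamma_plus1[of "\<mu> + real k + 1"] by (simp add: algebra_simps)
    then have 1: "rGamma (\<mu> + real k + 1) / fact k * y ^ k = (\<mu> + real k + 1) * c"
      by (simp add: c_def)
    have 2: "rGamma (\<mu> + real (Suc k) + 1) / fact (Suc k) * y ^ Suc k = y / real (Suc k) * c"
      by (simp add: c_def field_simps)
    have y: "\<bar>y\<bar> \<le> (\<mu> + real k + 1) / 2"
      using N of_nat_mono[OF k, where 'a = real] by (simp add: field_simps)
    have "\<bar>y / real (Suc k)\<bar> = \<bar>y\<bar> / real (Suc k)" by (simp add: abs_divide)
    also have "\<dots> \<le> \<bar>y\<bar>" by (simp add: field_simps)
    also have "\<dots> \<le> 1 / 2 * \<bar>\<mu> + real k + 1\<bar>"
      using y abs_ge_self[of "\<mu> + real k + 1"] by (simp add: field_simps)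
    finally have "\<bar>y / real (Suc k)\<bar> \<le> 1 / 2 * \<bar>\<mu> + real k + 1\<bar>" .
    then have "\<bar>y / real (Suc k)\<bar> * \<bar>c\<bar> \<le> 1 / 2 * \<bar>\<mu> + real k + 1\<bar> * \<bar>c\<bar>"
      by (rule mult_right_mono) simp
    then show "norm (rGamma (\<mu> + real (Suc k) + 1) / fact (Suc k) * y ^ Suc k)
        \<le> 1 / 2 * norm (rGamma (\<mu> + real k + 1) / fact k * y ^ k)"
      unfolding 1 2 real_norm_def abs_mult by simp
  qed simp
qed

lemma diffs_bessel_series:
  "diffs (\<lambda>k. rGamma (\<mu> + real k + 1) / fact k) = (\<lambda>k. rGamma (\<mu> + 1 + real k + 1) / fact k :: real)"
proof
  fix k
  show "diffs (\<lambda>k. rGamma (\<mu> + real k + 1) / fact k) k = (rGamma (\<mu> + 1 + real k + 1) / fact k :: real)"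
    unfolding diffs_def by (simp add: add_ac divide_simps)
qed

lemma bessel_series_has_derivative:
  "(bessel_series \<mu> has_real_derivative bessel_series (\<mu> + 1) y) (at y)"
  using termdiffs_strong_converges_everywhere[OF summable_bessel_series[of \<mu>], of y]
  unfolding bessel_series_def[abs_def] diffs_bessel_series by simp

text \<open>The functional equation of the reciprocal Gamma function supplies the factor \<mu> + k.
  Its part \<mu> reproduces the series, and its part k cancels into the factorial and shifts the
  index, which raises the order by one.\<close>

lemma bessel_series_recurrence:
  "bessel_series (\<mu> - 1) y = \<mu> * bessel_series \<mu> y + y * bessel_series (\<mu> + 1) y"
proof -
  let ?c = "\<lambda>\<mu> k. rGamma (\<mu> + real k + 1) / fact k * y ^ k"
  have s: "(\<lambda>k. ?c \<mu> k) sums bessel_series \<mu> y" for \<mu>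
    unfolding bessel_series_def by (rule summable_sums[OF summable_bessel_series])
  have "(\<lambda>k. real (Suc k) * ?c \<mu> (Suc k)) sums (y * bessel_series (\<mu> + 1) y)"
  proof -
    have eq: "y * ?c (\<mu> + 1) k = real (Suc k) * ?c \<mu> (Suc k)" for k
      by (simp add: add_ac divide_simps)
    then show ?thesis using sums_mult[OF s[of "\<mu> + 1"], of y] by (simp only: eq)
  qed
  then have "(\<lambda>k. real k * ?c \<mu> k) sums (y * bessel_series (\<mu> + 1) y)"
    by (subst (asm) sums_Suc_iff) simp
  then have "(\<lambda>k. \<mu> * ?c \<mu> k + real k * ?c \<mu> k) sums (\<mu> * bessel_series \<mu> y + y * bessel_series (\<mu> + 1) y)"
    by (intro sums_add sums_mult s)
  moreover have "\<mu> * ?c \<mu> k + real k * ?c \<mu> k = ?c (\<mu> - 1) k" for k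
  proof -
    have "rGamma (\<mu> + real k) = (\<mu> + real k) * rGamma (\<mu> + real k + 1)"
      using rGamma_plus1[of "\<mu> + real k"] by simp
    then show ?thesis by (simp add: distrib_right add_divide_distrib mult.assoc)
  qed
  ultimately show ?thesis using s[of "\<mu> - 1"] sums_unique2 by simp
qed

text \<open>Differentiation raises the order of the bare series and lowers it when the power is
  attached. In \<open>bessel_combination\<close>, built from the bare series of order -\<nu> and the
  weighted one of order \<nu>, both shifts amount to replacing \<nu> by \<nu> - 1.\<close>

lemma powr_bessel_series_has_derivative:
  assumes "y > 0"
  shows "((\<lambda>y. y powr \<mu> * bessel_series \<mu> y) has_real_derivative
           y powr (\<mu> - 1) * bessel_series (\<mu> - 1) y) (at y)"
proof -
  have "((\<lambda>y. y powr \<mu> * bessel_series \<mu> y) has_real_derivative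
      \<mu> * y powr (\<mu> - 1) * bessel_series \<mu> y + bessel_series (\<mu> + 1) y * y powr \<mu>) (at y)"
    by (intro DERIV_mult has_real_derivative_powr bessel_series_has_derivative assms)
  moreover have "y powr \<mu> = y * y powr (\<mu> - 1)" using assms by (simp add: powr_diff)
  ultimately show ?thesis
    by (simp add: bessel_series_recurrence[of \<mu>] algebra_simps)
qed

text \<open>For non-integral \<nu> this is 2 (x / 2)^\<nu> K_\<nu>(x) at y = x^2 / 4, by the
  defining quotient of K. At integral \<nu> the division by zero makes it 0, so the derivative rule
  and the symmetry below hold for every order.\<close>

definition bessel_combination :: "real \<Rightarrow> real \<Rightarrow> real" where
  "bessel_combination \<nu> y =
     pi / sin (\<nu> * pi) * (bessel_series (- \<nu>) y - y powr \<nu> * bessel_series \<nu> y)"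

lemma bessel_combination_has_derivative:
  assumes "y > 0"
  shows "(bessel_combination \<nu> has_real_derivative - bessel_combination (\<nu> - 1) y) (at y)"
proof -
  \<comment> \<open>This change of sign is the origin of the minus sign in the derivative
    rule.\<close>
  have "sin ((\<nu> - 1) * pi) = - sin (\<nu> * pi)"
    by (simp add: left_diff_distrib sin_diff)
  moreover have "(bessel_combination \<nu> has_real_derivative pi / sin (\<nu> * pi) *
      (bessel_series (- \<nu> + 1) y - y powr (\<nu> - 1) * bessel_series (\<nu> - 1) y)) (at y)"
    unfolding bessel_combination_def[abs_def]
    by (intro DERIV_cmult DERIV_diff bessel_series_has_derivative powr_bessel_series_has_derivative assms)
  ultimately show ?thesis by (simp add: bessel_combination_def)
qed

lemma bessel_combination_symmetric:
  assumes "y > 0"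
  shows "bessel_combination (- \<nu>) y = y powr (- \<nu>) * bessel_combination \<nu> y"
proof -
  have "y powr - \<nu> * y powr \<nu> = 1" using assms by (simp add: powr_add[symmetric])
  then have "y powr (- \<nu>) * (bessel_series (- \<nu>) y - y powr \<nu> * bessel_series \<nu> y)
      = y powr (- \<nu>) * bessel_series (- \<nu>) y - bessel_series \<nu> y"
    by (simp add: right_diff_distrib mult.assoc[symmetric])
  moreover have "pi / - s * (a - b) = pi / s * (b - a)" for s a b :: real
    by (simp add: divide_simps algebra_simps)
  ultimately show ?thesis
    unfolding bessel_combination_def by (simp add: mult.left_commute[of "y powr - \<nu>"])
qed

lemma rGamma_reflection_real: "rGamma x * rGamma (1 - x) = sin (x * pi) / (pi :: real)"
proof -
  have "complex_of_real (rGamma x * rGamma (1 - x)) = complex_of_real (sin (x * pi) / pi)"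
    using rGamma_reflection_complex[of "of_real x"]
    by (simp add: rGamma_complex_of_real[symmetric] sin_of_real[symmetric] mult.commute)
  then show ?thesis by (simp only: of_real_eq_iff)
qed

text \<open>As \<nu> > 0, the term with y powr \<nu> dies out, and the other series starts with the
  reciprocal of Gamma (1 - \<nu>). The reflection formula turns the prefactor times this value into
  Gamma \<nu>.\<close>

lemma bessel_combination_tendsto_Gamma:
  assumes \<nu>: "0 < \<nu>" "\<nu> < 1"
  shows "(bessel_combination \<nu> \<longlongrightarrow> Gamma \<nu>) (at_right 0)"
proof -
  have s: "(bessel_series \<mu> \<longlongrightarrow> rGamma (\<mu> + 1)) (at_right 0)" for \<mu>
  proof -
    have "isCont (bessel_series \<mu>) 0"
      using bessel_series_has_derivative DERIV_isCont by blast
    moreover have "bessel_series \<mu> 0 = rGamma (\<mu> + 1)"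
      unfolding bessel_series_def using powser_zero[of "\<lambda>k. rGamma (\<mu> + real k + 1) / fact k"] by simp
    ultimately show ?thesis by (auto simp: isCont_def intro: tendsto_within_subset)
  qed
  have p: "((\<lambda>y::real. y powr \<nu>) \<longlongrightarrow> 0) (at_right 0)"
    using \<nu> by (auto intro!: tendsto_eq_intros intro: eventually_mono[OF eventually_at_right_less])
  have "sin (\<nu> * pi) \<noteq> 0"
    using sin_gt_zero[of "\<nu> * pi"] \<nu> by simp
  moreover have "rGamma \<nu> \<noteq> 0" using \<nu> by (auto simp: rGamma_eq_zero_iff elim!: nonpos_Ints_cases)
  ultimately have "pi / sin (\<nu> * pi) * (rGamma (- \<nu> + 1) - 0 * rGamma (\<nu> + 1)) = Gamma \<nu>"
    using rGamma_reflection_real[of \<nu>] by (simp add: Gamma_def field_simps)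
  moreover have "(bessel_combination \<nu> \<longlongrightarrow> pi / sin (\<nu> * pi) * (rGamma (- \<nu> + 1) - 0 * rGamma (\<nu> + 1))) (at_right 0)"
    unfolding bessel_combination_def[abs_def] by (intro tendsto_intros s p)
  ultimately show ?thesis by simp
qed

text \<open>
  The difference of the two sides satisfies, together with its counterpart of order \<open>1 - \<nu>\<close>, a
  linear system whose coefficients \<open>y powr (\<nu> - 1)\<close> and \<open>y powr (- \<nu>)\<close> are integrable at 0, so
  Gronwall's argument applies from the singular point onwards.
\<close>
lemma exp_recip_integral_eq_bessel_combination_01:
  assumes \<nu>: "0 < \<nu>" "\<nu> < 1" and y: "y > 0"
  shows "exp_recip_integral \<nu> y = bessel_combination \<nu> y"
proof -
  define D where "D \<mu> y = exp_recip_integral \<mu> y - bessel_combination \<mu> y" for \<mu> y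
  have D': "(D \<mu> has_real_derivative - D (\<mu> - 1) y) (at y)" if "y > 0" for \<mu> y
    unfolding D_def[abs_def]
    using DERIV_diff[OF exp_recip_integral_has_derivative[OF that, of \<mu>] bessel_combination_has_derivative[OF that, of \<mu>]]
    by simp
  have sym: "D (- \<mu>) y = y powr (- \<mu>) * D \<mu> y" if "y > 0" for \<mu> y
    using that by (simp add: D_def exp_recip_integral_symmetric bessel_combination_symmetric right_diff_distrib)
  have D0: "(D \<mu> \<longlongrightarrow> 0) (at_right 0)" if "0 < \<mu>" "\<mu> < 1" for \<mu>
    unfolding D_def[abs_def]
    using tendsto_diff[OF exp_recip_integral_tendsto_Gamma bessel_combination_tendsto_Gamma] that by force
  \<comment> \<open>\<open>W\<close> is the squared norm of the solution of the linear system, and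
    \<open>g\<close> the antiderivative, vanishing at 0, of the sum of its two coefficients: the
    integrating factor exp (- g) is therefore bounded up to the singular point.\<close>
  define W where "W y = (D \<nu> y)\<^sup>2 + (D (1 - \<nu>) y)\<^sup>2" for y
  define g where "g y = y powr \<nu> / \<nu> + y powr (1 - \<nu>) / (1 - \<nu>)" for y :: real
  have g': "(g has_real_derivative (y powr (\<nu> - 1) + y powr (- \<nu>))) (at y)" if "y > 0" for y
    unfolding g_def[abs_def] using that \<nu> by (auto intro!: derivative_eq_intros)
  have W': "(W has_real_derivative - (2 * D \<nu> y * D (1 - \<nu>) y * (y powr (\<nu> - 1) + y powr (- \<nu>)))) (at y)"
    if "y > 0" for y
  proof -
    have e: "D (\<nu> - 1) y = y powr (\<nu> - 1) * D (1 - \<nu>) y" "D (- \<nu>) y = y powr (- \<nu>) * D \<nu> y"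
      using sym[OF that, of "1 - \<nu>"] sym[OF that, of \<nu>] by simp_all
    show ?thesis
      unfolding W_def[abs_def]
      by (rule derivative_eq_intros D' that refl)+ (simp add: e algebra_simps)
  qed
  have decr: "W y * exp (- g y) \<le> W x * exp (- g x)" if "0 < x" "x \<le> y" for x y
  proof (rule DERIV_nonpos_imp_nonincreasing[OF that(2)])
    fix t assume "x \<le> t" "t \<le> y"
    then have t: "t > 0" using that by simp
    let ?p = "t powr (\<nu> - 1) + t powr (- \<nu>)"
    have "((\<lambda>t. W t * exp (- g t)) has_real_derivative
        (- (2 * D \<nu> t * D (1 - \<nu>) t * ?p) - W t * ?p) * exp (- g t)) (at t)"
      by (rule derivative_eq_intros W' g' t refl)+ (simp add: algebra_simps)
    \<comment> \<open>The mixed term and \<open>W\<close> combine to a complete square, so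
      \<open>W\<close> damped by exp (- g) is non-increasing.\<close>
    moreover have "- (2 * D \<nu> t * D (1 - \<nu>) t * ?p) - W t * ?p = - ((D \<nu> t + D (1 - \<nu>) t)\<^sup>2 * ?p)"
      by (simp add: W_def power2_eq_square algebra_simps)
    ultimately show "\<exists>d. ((\<lambda>t. W t * exp (- g t)) has_real_derivative d) (at t) \<and> d \<le> 0"
      by (auto simp del: distrib_left_numeral)
  qed
  \<comment> \<open>Comparison of y with points x approaching 0: there exp (- g x) \<le> 1 and W x
    tends to 0, which forces W y \<le> 0.\<close>
  have "(W \<longlongrightarrow> 0\<^sup>2 + 0\<^sup>2) (at_right 0)"
    unfolding W_def[abs_def] using \<nu> by (intro tendsto_intros D0) auto
  then have "W y * exp (- g y) \<le> 0\<^sup>2 + 0\<^sup>2"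
  proof (rule tendsto_lowerbound)
    show "\<forall>\<^sub>F x in at_right 0. W y * exp (- g y) \<le> W x"
      unfolding eventually_at_right_field
    proof (intro exI[of _ y] conjI allI impI y)
      fix x assume "0 < x" "x < y"
      have "0 \<le> g x"
        unfolding g_def using \<nu> by (intro add_nonneg_nonneg divide_nonneg_nonneg) auto
      then have "W x * exp (- g x) \<le> W x * 1"
        by (intro mult_left_mono) (auto simp: W_def)
      moreover have "W y * exp (- g y) \<le> W x * exp (- g x)"
        using \<open>0 < x\<close> \<open>x < y\<close> by (intro decr) auto
      ultimately show "W y * exp (- g y) \<le> W x" by simp
    qed
  qed auto
  then have "W y \<le> 0" by (simp add: mult_le_0_iff)
  then have "D \<nu> y = 0" unfolding W_def by (simp add: sum_power2_le_zero_iff)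
  then show ?thesis by (simp add: D_def)
qed

text \<open>The derivative rule only moves the order downwards, so it reaches the orders below 1,
  written as frac \<nu> - n; the larger ones are reflected by the symmetry.\<close>

lemma exp_recip_integral_eq_bessel_combination:
  assumes \<nu>: "\<nu> \<notin> \<int>" and y: "y > 0"
  shows "exp_recip_integral \<nu> y = bessel_combination \<nu> y"
proof -
  have down: "\<forall>y>0. exp_recip_integral (\<mu> - real n) y = bessel_combination (\<mu> - real n) y"
    if \<mu>: "0 < \<mu>" "\<mu> < 1" for \<mu> n
  proof (induction n)
    case 0
    then show ?case using exp_recip_integral_eq_bessel_combination_01[OF \<mu>] by simp
  next
    case (Suc n)
    show ?case
    proof (intro allI impI)
      fix y :: real assume y: "y > 0"
      let ?k = "\<mu> - real n"
      \<comment> \<open>Two functions that agree on the whole open half-line have the same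
        derivative there. For this the induction hypothesis quantifies over all y > 0.\<close>
      have "(exp_recip_integral ?k has_real_derivative - bessel_combination (?k - 1) y) (at y)"
        using bessel_combination_has_derivative[OF y]
      proof (rule has_field_derivative_transform_within_open[of _ _ _ "{0<..}"])
        fix x :: real assume "x \<in> {0<..}"
        then show "bessel_combination ?k x = exp_recip_integral ?k x" using Suc.IH by simp
      qed (use y in auto)
      from DERIV_unique[OF this exp_recip_integral_has_derivative[OF y]]
      show "exp_recip_integral (\<mu> - real (Suc n)) y = bessel_combination (\<mu> - real (Suc n)) y"
        by (simp add: algebra_simps)
    qed
  qed
  have neg: "exp_recip_integral \<nu> y = bessel_combination \<nu> y" if "\<nu> < 1" "\<nu> \<notin> \<int>" for \<nu>
  proof -
    define n where "n = nat (- \<lfloor>\<nu>\<rfloor>)"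
    have "\<lfloor>\<nu>\<rfloor> \<le> 0" using that by (simp add: floor_le_iff)
    then have n: "real n = - of_int \<lfloor>\<nu>\<rfloor>" by (simp add: n_def)
    have "frac \<nu> \<noteq> 0" using that by simp
    then have "0 < frac \<nu>" "frac \<nu> < 1" using frac_ge_0[of \<nu>] frac_lt_1[of \<nu>] by linarith+
    from down[OF this, of n] y show ?thesis by (simp add: n frac_def)
  qed
  show ?thesis
  proof (cases "\<nu> < 1")
    case False
    have "- \<nu> \<notin> \<int>" using \<nu> by simp
    with False have "exp_recip_integral (- \<nu>) y = bessel_combination (- \<nu>) y" by (intro neg) auto
    then show ?thesis
      using y by (simp add: exp_recip_integral_symmetric bessel_combination_symmetric)
  qed (use neg \<nu> in auto)
qed

section \<open>Return to the modified Bessel functions\<close>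

lemma besselI_eq_bessel_series:
  assumes "x > 0"
  shows "besselI \<nu> x = (x / 2) powr \<nu> * bessel_series \<nu> (x\<^sup>2 / 4)"
proof -
  have "(x / 2) powr (2 * real k + \<nu>) = (x / 2) powr \<nu> * (x\<^sup>2 / 4) ^ k" for k
  proof -
    have "(x / 2) powr (2 * real k) = (x / 2) ^ (2 * k)"
      using assms by (subst powr_realpow[symmetric]) auto
    also have "\<dots> = (x\<^sup>2 / 4) ^ k" by (simp add: power_mult power_divide)
    finally show ?thesis by (simp add: powr_add)
  qed
  then show ?thesis
    unfolding besselI_def bessel_series_def
    by (subst suminf_mult[OF summable_bessel_series, symmetric]) (simp add: mult_ac)
qed

theorem besselK_integral_representation:
  assumes x: "x > 0"
  shows "besselK \<nu> x = 1 / 2 * (x / 2) powr (- \<nu>) * exp_recip_integral \<nu> (x\<^sup>2 / 4)"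
proof -
  define q where "q = (\<lambda>\<mu>. pi / 2 * (besselI (- \<mu>) x - besselI \<mu> x) / sin (\<mu> * pi))"
  define r where "r = (\<lambda>\<mu>. 1 / 2 * (x / 2) powr (- \<mu>) * exp_recip_integral \<mu> (x\<^sup>2 / 4))"
  have qr: "q \<mu> = r \<mu>" if "\<mu> \<notin> \<int>" for \<mu>
  proof -
    have "(x\<^sup>2 / 4) powr \<mu> = ((x / 2) powr \<mu>)\<^sup>2"
      using powr_mult[of "x / 2" "x / 2" \<mu>] x by (simp add: power2_eq_square)
    then have "(x / 2) powr (- \<mu>) * (x\<^sup>2 / 4) powr \<mu> = (x / 2) powr \<mu>"
      using x by (simp add: powr_minus power2_eq_square)
    then have "(x / 2) powr (- \<mu>) * (bessel_series (- \<mu>) (x\<^sup>2 / 4) - (x\<^sup>2 / 4) powr \<mu> * bessel_series \<mu> (x\<^sup>2 / 4))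
        = besselI (- \<mu>) x - besselI \<mu> x"
      using x by (simp add: besselI_eq_bessel_series right_diff_distrib flip: mult.assoc)
    then show ?thesis
      using x that
      by (simp add: q_def r_def exp_recip_integral_eq_bessel_combination bessel_combination_def mult.left_commute)
  qed
  have lim: "(r \<longlongrightarrow> r \<nu>) (at \<nu>)"
    unfolding r_def using x by (intro tendsto_intros exp_recip_integral_continuous_order) auto
  \<comment> \<open>Within distance 1 of an integer there is no other integer, so on this punctured
    neighbourhood \<open>q\<close> agrees with \<open>r\<close>, which is continuous in the
    order.\<close>
  have "Lim (at \<nu>) q = r \<nu>" if "\<nu> \<in> \<int>"
  proof (rule tendsto_Lim)
    have "\<forall>\<^sub>F \<mu> in at \<nu>. r \<mu> = q \<mu>"
      unfolding eventually_at
    proof (intro exI[of _ 1] conjI ballI impI)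
      fix \<mu> :: real assume "\<mu> \<noteq> \<nu> \<and> dist \<mu> \<nu> < 1"
      then have "\<mu> - \<nu> \<notin> \<int>"
        using Ints_nonzero_abs_less1[of "\<mu> - \<nu>"] by (auto simp: dist_real_def)
      then show "r \<mu> = q \<mu>" using Ints_diff[OF _ that] qr by metis
    qed simp
    then show "(q \<longlongrightarrow> r \<nu>) (at \<nu>)"
      by (rule Lim_transform_eventually[OF lim])
  qed simp
  then have "besselK \<nu> x = r \<nu>"
    using qr unfolding besselK_def Let_def q_def[symmetric] by simp
  then show ?thesis by (simp add: r_def)
qed

section \<open>The generalized inverse Gaussian distribution\<close>

text \<open>The scaling s = (\<omega> / 2) t maps -s - (\<omega>^2 / 4) / s to the exponent of the
  density. The factor (\<omega> / 2) powr l that it produces cancels against the one in the integral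
  representation of K.\<close>

lemma gig_kernel_integral:
  assumes "\<omega> > (0::real)"
  shows "set_integrable lborel {0<..} (\<lambda>t. t powr (l - 1) * exp (- (\<omega> / 2) * (1 / t + t)))"
    and "(LBINT t:{0<..}. t powr (l - 1) * exp (- (\<omega> / 2) * (1 / t + t))) = 2 * besselK l \<omega>"
proof -
  let ?f = "\<lambda>s. s powr (l - 1) * exp (- s - (\<omega>\<^sup>2 / 4) / s)"
  let ?g = "\<lambda>t. t powr (l - 1) * exp (- (\<omega> / 2) * (1 / t + t))"
  have scale: "indicator {0<..} (0 + \<omega> / 2 * t) *\<^sub>R ?f (0 + \<omega> / 2 * t)
      = (\<omega> / 2) powr (l - 1) * (indicator {0<..} t *\<^sub>R ?g t)" for t
  proof (cases "t > 0")
    case True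
    have "(\<omega>\<^sup>2 / 4) / (\<omega> / 2 * t) = \<omega> / 2 * (1 / t)"
      using True assms by (simp add: power2_eq_square)
    then have E: "exp (- (\<omega> / 2 * t) - (\<omega>\<^sup>2 / 4) / (\<omega> / 2 * t)) = exp (- (\<omega> / 2) * (1 / t + t))"
      by (simp add: algebra_simps)
    have P: "(\<omega> / 2 * t) powr (l - 1) = (\<omega> / 2) powr (l - 1) * t powr (l - 1)"
      by (rule powr_mult)
    show ?thesis unfolding add_0 E P using True assms by simp
  next
    case False
    then have "\<not> 0 < \<omega> / 2 * t" using assms by (simp add: zero_less_mult_iff)
    then show ?thesis using False by simp
  qed
  have c: "(\<omega> / 2) powr (l - 1) \<noteq> 0" "\<omega> / 2 \<noteq> 0" "\<omega>\<^sup>2 / 4 > 0" using assms by auto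
  have "integrable lborel (\<lambda>s. indicator {0<..} s *\<^sub>R ?f s)"
    using exp_recip_integrable[OF c(3), of l] by (simp add: set_integrable_def)
  then have "integrable lborel (\<lambda>t. indicator {0<..} (0 + \<omega> / 2 * t) *\<^sub>R ?f (0 + \<omega> / 2 * t))"
    by (rule lborel_integrable_real_affine[OF _ c(2)])
  then show "set_integrable lborel {0<..} ?g"
    unfolding scale set_integrable_def using c(1) by (subst (asm) integrable_mult_left_iff) auto
  have "exp_recip_integral l (\<omega>\<^sup>2 / 4) = \<bar>\<omega> / 2\<bar> *\<^sub>R (LBINT t. (\<omega> / 2) powr (l - 1) * (indicator {0<..} t *\<^sub>R ?g t))"
    unfolding exp_recip_integral_def set_lebesgue_integral_def
    by (subst lborel_integral_real_affine[OF c(2), of _ 0]) (simp only: scale)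
  also have "\<dots> = (\<omega> / 2) powr l * (LBINT t:{0<..}. ?g t)"
  proof -
    have "\<bar>\<omega> / 2\<bar> * (\<omega> / 2) powr (l - 1) = (\<omega> / 2) powr l"
      using assms by (simp add: powr_diff)
    then show ?thesis
      unfolding real_scaleR_def integral_mult_right_zero set_lebesgue_integral_def
      by (simp only: mult.assoc[symmetric])
  qed
  finally have "exp_recip_integral l (\<omega>\<^sup>2 / 4) = (\<omega> / 2) powr l * (LBINT t:{0<..}. ?g t)" .
  moreover have "(\<omega> / 2) powr - l * (\<omega> / 2) powr l = 1"
    using assms by (simp flip: powr_add)
  ultimately show "(LBINT t:{0<..}. ?g t) = 2 * besselK l \<omega>"
    unfolding besselK_integral_representation[OF assms] by (simp flip: mult.assoc)
qed

lemma besselK_pos: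
  assumes "\<omega> > 0"
  shows "besselK l \<omega> > 0"
  using assms exp_recip_integral_pos[of "\<omega>\<^sup>2 / 4" l]
  by (simp add: besselK_integral_representation)

section \<open>The distribution function and its inverse\<close>

context
  fixes l \<omega> :: real
  assumes \<omega>: "\<omega> > 0"
begin

lemma gig_pdf_pos: "x > 0 \<Longrightarrow> gig_pdf l \<omega> x > 0"
  using besselK_pos[OF \<omega>, of l] by (simp add: gig_pdf_def)

text \<open>The half-line may be closed because \<open>gig_pdf\<close> is 0 at 0, where
  \<open>powr\<close> vanishes. Closed intervals allow the distribution function to be read as an
  indefinite Henstock-Kurzweil integral.\<close>

lemma gig_pdf_integrable: "set_integrable lborel {0..} (gig_pdf l \<omega>)"
  and gig_pdf_integral: "(LBINT t:{0..}. gig_pdf l \<omega> t) = 1"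
proof -
  let ?g = "\<lambda>t. t powr (l - 1) * exp (- (\<omega> / 2) * (1 / t + t))"
  have eq: "(\<lambda>t. indicator {0..} t *\<^sub>R gig_pdf l \<omega> t)
      = (\<lambda>t. 1 / (2 * besselK l \<omega>) * (indicator {0<..} t *\<^sub>R ?g t))"
    by (auto simp: fun_eq_iff indicator_def gig_pdf_def)
  show "set_integrable lborel {0..} (gig_pdf l \<omega>)"
    unfolding set_integrable_def eq
    using gig_kernel_integral(1)[OF \<omega>, of l]
    by (intro integrable_mult_right) (simp add: set_integrable_def)
  show "(LBINT t:{0..}. gig_pdf l \<omega> t) = 1"
    unfolding set_lebesgue_integral_def eq
    using gig_kernel_integral(2)[OF \<omega>, of l] besselK_pos[OF \<omega>, of l]
    by (simp add: set_lebesgue_integral_def)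
qed

lemma gig_pdf_integrable_Icc: "gig_pdf l \<omega> integrable_on {0..x}"
  by (rule set_borel_integral_eq_integral(1)[OF set_integrable_subset[OF gig_pdf_integrable]]) auto

lemma gig_cdf_eq_LBINT: "gig_cdf l \<omega> x = (LBINT t:{0..x}. gig_pdf l \<omega> t)"
  unfolding gig_cdf_def set_lebesgue_integral_def
  by (intro Bochner_Integration.integral_cong refl) (auto simp: indicator_def gig_pdf_def)

lemma gig_cdf_eq_integral: "gig_cdf l \<omega> x = integral {0..x} (gig_pdf l \<omega>)"
  unfolding gig_cdf_eq_LBINT
  by (rule set_borel_integral_eq_integral(2)[OF set_integrable_subset[OF gig_pdf_integrable]]) auto

text \<open>The base point of the integral is moved to x / 2, so that continuity of the density is
  asked for only away from 0.\<close>

lemma gig_cdf_has_derivative: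
  assumes x: "x > 0"
  shows "(gig_cdf l \<omega> has_real_derivative gig_pdf l \<omega> x) (at x)"
proof -
  have "continuous_on {x / 2..2 * x} (gig_pdf l \<omega>)"
    unfolding gig_pdf_def[abs_def] using x by (intro continuous_intros) auto
  then have "((\<lambda>y. integral {x / 2..y} (gig_pdf l \<omega>)) has_real_derivative gig_pdf l \<omega> x) (at x within {x / 2..2 * x})"
    by (rule integral_has_real_derivative) (use x in auto)
  then have "((\<lambda>y. integral {x / 2..y} (gig_pdf l \<omega>)) has_real_derivative gig_pdf l \<omega> x) (at x)"
    using x by (subst (asm) at_within_interior) auto
  then have "((\<lambda>y. gig_cdf l \<omega> (x / 2) + integral {x / 2..y} (gig_pdf l \<omega>)) has_real_derivative gig_pdf l \<omega> x) (at x)"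
    by (auto intro!: derivative_eq_intros)
  then show ?thesis
  proof (rule has_field_derivative_transform_within_open[of _ _ _ "{x / 2<..}"])
    fix y assume "y \<in> {x / 2<..}"
    then show "gig_cdf l \<omega> (x / 2) + integral {x / 2..y} (gig_pdf l \<omega>) = gig_cdf l \<omega> y"
      unfolding gig_cdf_eq_integral using x
      by (intro Henstock_Kurzweil_Integration.integral_combine gig_pdf_integrable_Icc) auto
  qed (use x in auto)
qed

lemma gig_cdf_strict_mono: "0 < x \<Longrightarrow> x < y \<Longrightarrow> gig_cdf l \<omega> x < gig_cdf l \<omega> y"
  by (rule DERIV_pos_imp_increasing[where f = "gig_cdf l \<omega>"])
     (auto intro!: exI[of _ "gig_pdf l \<omega> _"] gig_cdf_has_derivative gig_pdf_pos)

lemma gig_cdf_mono: "0 < x \<Longrightarrow> x \<le> y \<Longrightarrow> gig_cdf l \<omega> x \<le> gig_cdf l \<omega> y"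
  using gig_cdf_strict_mono[of x y] by fastforce

lemma gig_cdf_inj: "inj_on (gig_cdf l \<omega>) {0<..}"
  by (rule linorder_inj_onI) (auto dest: gig_cdf_strict_mono)

lemma gig_cdf_tendsto_0: "(gig_cdf l \<omega> \<longlongrightarrow> 0) (at_right 0)"
proof -
  have "continuous_on {0..1} (gig_cdf l \<omega>)"
    unfolding gig_cdf_eq_integral[abs_def]
    by (intro indefinite_integral_continuous_1 gig_pdf_integrable_Icc)
  then have "(gig_cdf l \<omega> \<longlongrightarrow> gig_cdf l \<omega> 0) (at 0 within {0..1})"
    by (auto simp: continuous_on_def)
  then show ?thesis
    by (simp add: at_within_Icc_at_right gig_cdf_eq_integral)
qed

text \<open>Here the exact value of K enters: the limit is the total mass, which
  \<open>gig_kernel_integral\<close> makes equal to 1.\<close>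

lemma gig_cdf_tendsto_1: "(gig_cdf l \<omega> \<longlongrightarrow> 1) at_top"
proof -
  have "((\<lambda>x. LBINT t. indicator {0..x} t *\<^sub>R gig_pdf l \<omega> t) \<longlongrightarrow> (LBINT t. indicator {0..} t *\<^sub>R gig_pdf l \<omega> t)) at_top"
  proof (rule integral_dominated_convergence_at_top)
    show "integrable lborel (\<lambda>t. \<bar>indicator {0..} t *\<^sub>R gig_pdf l \<omega> t\<bar>)"
      using gig_pdf_integrable by (intro integrable_abs) (simp add: set_integrable_def)
    show "\<forall>\<^sub>F x in at_top. AE t in lborel. norm (indicator {0..x} t *\<^sub>R gig_pdf l \<omega> t) \<le> \<bar>indicator {0..} t *\<^sub>R gig_pdf l \<omega> t\<bar>"
      by (auto simp: indicator_def)
    show "AE t in lborel. ((\<lambda>x. indicator {0..x} t *\<^sub>R gig_pdf l \<omega> t) \<longlongrightarrow> indicator {0..} t *\<^sub>R gig_pdf l \<omega> t) at_top"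
    proof (intro AE_I2 tendsto_eventually)
      fix t :: real
      show "\<forall>\<^sub>F x in at_top. indicator {0..x} t *\<^sub>R gig_pdf l \<omega> t = indicator {0..} t *\<^sub>R gig_pdf l \<omega> t"
        using eventually_ge_at_top[of t] by eventually_elim (auto simp: indicator_def)
    qed
  qed (use borel_measurable_integrable[OF gig_pdf_integrable[unfolded set_integrable_def]] in \<open>auto simp: gig_pdf_def[abs_def]\<close>)
  then show ?thesis
    using gig_pdf_integral unfolding gig_cdf_eq_LBINT[abs_def] set_lebesgue_integral_def by simp
qed

lemma gig_cdf_pos: 
  assumes "x > 0"
  shows "gig_cdf l \<omega> x > 0"
proof -
  have "gig_cdf l \<omega> (x / 2) \<ge> 0"
  proof (rule tendsto_upperbound[OF gig_cdf_tendsto_0])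
    show "\<forall>\<^sub>F y in at_right 0. gig_cdf l \<omega> y \<le> gig_cdf l \<omega> (x / 2)"
      unfolding eventually_at_right_field using assms
      by (intro exI[of _ "x / 2"]) (auto intro: gig_cdf_mono)
  qed auto
  then show ?thesis using gig_cdf_strict_mono[of "x / 2" x] assms by simp
qed

lemma gig_cdf_less_1:
  assumes "x > 0"
  shows "gig_cdf l \<omega> x < 1"
proof -
  have "gig_cdf l \<omega> (x + 1) \<le> 1"
  proof (rule tendsto_lowerbound[OF gig_cdf_tendsto_1])
    show "\<forall>\<^sub>F y in at_top. gig_cdf l \<omega> (x + 1) \<le> gig_cdf l \<omega> y"
      using eventually_gt_at_top[of "x + 1"]
      by eventually_elim (use assms in \<open>auto intro: gig_cdf_mono\<close>)
  qed auto
  then show ?thesis using gig_cdf_strict_mono[of x "x + 1"] assms by simp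
qed

lemma gig_cdf_surj:
  assumes u: "0 < u" "u < 1"
  shows "\<exists>x>0. gig_cdf l \<omega> x = u"
proof -
  obtain a where a: "0 < a" "gig_cdf l \<omega> a < u"
  proof -
    have "\<forall>\<^sub>F x in at_right 0. gig_cdf l \<omega> x < u \<and> 0 < x"
      using order_tendstoD(2)[OF gig_cdf_tendsto_0 u(1)] eventually_at_right_less
      by (rule eventually_conj)
    then show ?thesis using that eventually_happens'[OF trivial_limit_at_right_real] by blast
  qed
  obtain b where b: "a < b" "u < gig_cdf l \<omega> b"
  proof -
    have "\<forall>\<^sub>F x in at_top. u < gig_cdf l \<omega> x \<and> a < x"
      using order_tendstoD(1)[OF gig_cdf_tendsto_1 u(2)] eventually_gt_at_top
      by (rule eventually_conj)
    then show ?thesis using that eventually_happens'[OF trivial_limit_at_top_linorder] by blast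
  qed
  have "\<exists>x. a \<le> x \<and> x \<le> b \<and> gig_cdf l \<omega> x = u"
    using a b by (intro IVT) (auto intro!: DERIV_isCont[OF gig_cdf_has_derivative])
  then show ?thesis using a(1) less_le_trans by blast
qed

lemma gig_quantile:
  assumes "0 < u" "u < 1"
  shows gig_quantile_pos: "gig_quantile l \<omega> u > 0"
    and gig_cdf_quantile: "gig_cdf l \<omega> (gig_quantile l \<omega> u) = u"
proof -
  have u: "u \<in> gig_cdf l \<omega> ` {0<..}" using gig_cdf_surj[OF assms] by force
  show "gig_quantile l \<omega> u > 0"
    using the_inv_into_into[OF gig_cdf_inj u order.refl] by (simp add: gig_quantile_def)
  show "gig_cdf l \<omega> (gig_quantile l \<omega> u) = u"
    unfolding gig_quantile_def by (rule f_the_inv_into_f[OF gig_cdf_inj u])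
qed

lemma gig_quantile_cdf: "x > 0 \<Longrightarrow> gig_quantile l \<omega> (gig_cdf l \<omega> x) = x"
  unfolding gig_quantile_def by (rule the_inv_into_f_f[OF gig_cdf_inj]) simp

lemma gig_quantile_has_derivative:
  assumes u: "0 < u" "u < 1"
  shows "(gig_quantile l \<omega> has_real_derivative inverse (gig_pdf l \<omega> (gig_quantile l \<omega> u))) (at u)"
proof -
  let ?x = "gig_quantile l \<omega> u"
  have x: "?x > 0" by (rule gig_quantile_pos[OF u])
  \<comment> \<open>A radius of half the point keeps the neighbourhood in the positive half-line,
    where the distribution function is continuous and inverted by the quantile function.\<close>
  have "isCont (gig_quantile l \<omega>) (gig_cdf l \<omega> ?x)"
  proof (rule isCont_inverse_function[where f = "gig_cdf l \<omega>" and x = ?x and d = "?x / 2"])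
    fix z assume "\<bar>z - ?x\<bar> \<le> ?x / 2"
    then have z: "z > 0" using x by linarith
    show "gig_quantile l \<omega> (gig_cdf l \<omega> z) = z" by (rule gig_quantile_cdf[OF z])
    show "isCont (gig_cdf l \<omega>) z" by (rule DERIV_isCont[OF gig_cdf_has_derivative[OF z]])
  qed (use x in simp)
  then show ?thesis
    using gig_pdf_pos[OF x] u gig_cdf_has_derivative[OF x]
    by (intro DERIV_inverse_function[where f = "gig_cdf l \<omega>" and a = 0 and b = 1])
       (auto simp: gig_cdf_quantile)
qed

lemma gig_mode_pos: "gig_mode l \<omega> > 0"
proof -
  have "\<bar>l - 1\<bar> = sqrt ((l - 1)\<^sup>2)" by simp
  also have "\<dots> < sqrt ((l - 1)\<^sup>2 + \<omega>\<^sup>2)" using \<omega> by (intro real_sqrt_less_mono) simp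
  finally have "l - 1 + sqrt ((l - 1)\<^sup>2 + \<omega>\<^sup>2) > 0" by linarith
  then show ?thesis using \<omega> by (simp add: gig_mode_def)
qed

lemma p_mode_pos: "0 < p_mode l \<omega>" and p_mode_less_1: "p_mode l \<omega> < 1"
  unfolding p_mode_def by (intro gig_cdf_pos gig_cdf_less_1 gig_mode_pos)+

end

section \<open>Holomorphic extension of solutions of separable equations\<close>

lemma eventually_nhds_of_real:
  fixes z0 :: real
  assumes "\<forall>\<^sub>F w in nhds (complex_of_real z0). P w"
  shows "\<forall>\<^sub>F z in nhds z0. P (complex_of_real z)"
proof -
  have "((\<lambda>z. complex_of_real z) \<longlongrightarrow> of_real z0) (nhds z0)"
    by (intro tendsto_of_real filterlim_ident)
  then show ?thesis using assms by (simp add: filterlim_iff)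
qed

text \<open>
  Separating variables turns the equation into \<open>F (A z) = B z + const\<close> with \<open>F' = f\<close>. The
  holomorphic extension of \<open>F\<close> is locally invertible, so the real solution extends too.
\<close>
lemma separable_ivp_holomorphic_extension:
  fixes f \<beta> A :: "real \<Rightarrow> real" and fc Bc :: "complex \<Rightarrow> complex"
  assumes S: "open S" "convex S" "complex_of_real x0 \<in> S"
    and fc: "fc holomorphic_on S" "fc (of_real x0) \<noteq> 0"
    and fc_real: "\<And>x. complex_of_real x \<in> S \<Longrightarrow> fc (of_real x) = of_real (f x)"
    and Bc: "Bc analytic_on {complex_of_real z0}"
    and Bc_real: "\<forall>\<^sub>F z in nhds z0. deriv Bc (of_real z) = of_real (\<beta> z)"
    and A0: "A z0 = x0"
    and A': "\<forall>\<^sub>F z in nhds z0. (A has_real_derivative \<beta> z / f (A z)) (at z)"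
  obtains Ac where "Ac analytic_on {complex_of_real z0}" "Ac (of_real z0) = of_real x0"
    "\<forall>\<^sub>F z in nhds z0. Ac (of_real z) = of_real (A z)"
    "\<forall>\<^sub>F w in nhds (of_real z0). (Ac has_field_derivative deriv Bc w / fc (Ac w)) (at w)"
proof -
  let ?x0 = "complex_of_real x0" and ?z0 = "complex_of_real z0"
  have "\<exists>F. \<forall>x\<in>S. (F has_field_derivative fc x) (at x within S)"
  proof (rule holomorphic_convex_primitive'[OF S(2,1) fc(1)])
    fix g assume "\<And>x. x \<in> S \<Longrightarrow> (g has_field_derivative fc x) (at x within S)"
    then show ?thesis by (intro exI[of _ g] ballI)
  qed
  then obtain F where F: "\<forall>x\<in>S. (F has_field_derivative fc x) (at x within S)" ..
  have F': "(F has_field_derivative fc x) (at x)" if "x \<in> S" for x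
    using bspec[OF F that] unfolding at_within_open[OF that S(1)] .
  have F_hol: "F holomorphic_on S"
    unfolding holomorphic_on_open[OF S(1)] by (intro ballI, rule exI, erule F')
  have dnz: "deriv F ?x0 \<noteq> 0" using DERIV_imp_deriv[OF F'[OF S(3)]] fc(2) by simp
  obtain r where r: "r > 0" "ball ?x0 r \<subseteq> S" "open (F ` ball ?x0 r)" "inj_on F (ball ?x0 r)"
    by (rule has_complex_derivative_locally_invertible[OF F_hol S(3,1) dnz])
  let ?U = "ball ?x0 r"
  obtain g where g: "g holomorphic_on (F ` ?U)"
      "\<And>z. z \<in> ?U \<Longrightarrow> deriv F z * deriv g (F z) = 1" "\<And>z. z \<in> ?U \<Longrightarrow> g (F z) = z"
  proof (rule holomorphic_has_inverse[OF holomorphic_on_subset[OF F_hol r(2)] open_ball r(4)])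
    fix g assume "g holomorphic_on (F ` ?U)"
      "\<And>z. z \<in> ?U \<Longrightarrow> deriv F z * deriv g (F z) = 1" "\<And>z. z \<in> ?U \<Longrightarrow> g (F z) = z"
    then show ?thesis by (rule that)
  qed
  \<comment> \<open>\<open>P\<close> is the right-hand side of F (A z) = P z; its constant of
    integration is fixed by the initial condition, so that P z0 = F x0 and the local inverse
    \<open>g\<close> of \<open>F\<close> applies near z0.\<close>
  define P where "P w = F ?x0 + (Bc w - Bc ?z0)" for w
  define Ac where "Ac w = g (P w)" for w
  have P0: "P ?z0 \<in> F ` ?U" using r(1) by (simp add: P_def)
  have P_an: "P analytic_on {?z0}" unfolding P_def[abs_def] by (intro analytic_intros Bc)
  have "isCont P ?z0" using P_an by (rule analytic_at_imp_isCont)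
  then have "(P \<longlongrightarrow> P ?z0) (nhds ?z0)" by (simp add: isCont_def tendsto_at_iff_tendsto_nhds)
  then have P_in: "\<forall>\<^sub>F w in nhds ?z0. P w \<in> F ` ?U"
    using topological_tendstoD[OF _ r(3) P0] by blast
  have Bc_diff: "\<forall>\<^sub>F w in nhds ?z0. (Bc has_field_derivative deriv Bc w) (at w)"
  proof -
    obtain T where T: "open T" "?z0 \<in> T" "Bc holomorphic_on T" using Bc by (auto simp: analytic_at)
    show ?thesis
      using eventually_nhds_in_open[OF T(1,2)]
      by eventually_elim (rule holomorphic_derivI[OF T(3,1)])
  qed
  show thesis
  proof (rule that)
    show "Ac analytic_on {?z0}"
      unfolding Ac_def[abs_def]
    proof (rule analytic_on_compose_gen[OF P_an, of g "F ` ?U", unfolded o_def])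
      show "g analytic_on F ` ?U" using g(1) r(3) by (simp add: analytic_on_open)
    qed (use P0 in auto)
    show "Ac ?z0 = ?x0" using g(3) r(1) by (simp add: Ac_def P_def)
    show "\<forall>\<^sub>F w in nhds ?z0. (Ac has_field_derivative deriv Bc w / fc (Ac w)) (at w)"
      using P_in Bc_diff
    proof eventually_elim
      case (elim w)
      then obtain v where v: "v \<in> ?U" "P w = F v" by blast
      have "(P has_field_derivative deriv Bc w) (at w)"
        unfolding P_def[abs_def] using elim(2) by (auto intro!: derivative_eq_intros)
      moreover have "(g has_field_derivative deriv g (P w)) (at (P w))"
        using g(1) r(3) elim(1) by (rule holomorphic_derivI)
      ultimately have "(Ac has_field_derivative deriv g (P w) * deriv Bc w) (at w)"
        unfolding Ac_def[abs_def] by (rule DERIV_chain2[rotated])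
      moreover have "fc v * deriv g (P w) = 1"
        using g(2)[OF v(1)] DERIV_imp_deriv[OF F'[of v]] v r(2) by auto
      then have "deriv g (P w) = 1 / fc (Ac w)"
        using g(3)[OF v(1)] v(2) by (metis Ac_def inverse_eq_divide inverse_unique)
      ultimately show ?case by simp
    qed
    have "isCont A z0" using eventually_nhds_x_imp_x[OF A'] DERIV_isCont by blast
    then have "((\<lambda>z. complex_of_real (A z)) \<longlongrightarrow> of_real (A z0)) (nhds z0)"
      by (intro tendsto_of_real) (simp add: isCont_def tendsto_at_iff_tendsto_nhds)
    then have "\<forall>\<^sub>F z in nhds z0. complex_of_real (A z) \<in> ?U"
      using A0 r(1) by (intro topological_tendstoD) auto
    then have "\<forall>\<^sub>F z in nhds z0. of_real (A z) \<in> ?U \<and> (A has_real_derivative \<beta> z / f (A z)) (at z)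
        \<and> (Bc has_field_derivative of_real (\<beta> z)) (at (of_real z)) \<and> fc (of_real (A z)) \<noteq> 0"
      using A' Bc_real eventually_nhds_of_real[OF Bc_diff]
    proof eventually_elim
      case (elim z)
      \<comment> \<open>Injectivity of \<open>F\<close> on the ball makes its derivative
        non-vanishing on all of it, not only at x0; hence the quotient in the real equation is a
        genuine one.\<close>
      have "fc (of_real (A z)) \<noteq> 0"
        using g(2)[OF elim(1)] DERIV_imp_deriv[OF F'[OF subsetD[OF r(2) elim(1)]]] by auto
      then show ?case using elim by simp
    qed
    then obtain e where e: "e > 0" and loc: "\<And>z. dist z z0 < e \<Longrightarrow> of_real (A z) \<in> ?U \<and>
        (A has_real_derivative \<beta> z / f (A z)) (at z)
        \<and> (Bc has_field_derivative of_real (\<beta> z)) (at (of_real z)) \<and> fc (of_real (A z)) \<noteq> 0"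
      unfolding eventually_nhds_metric by blast
    \<comment> \<open>F (A z) - Bc z is a conserved quantity of the given real solution. Being
      constant, it identifies F (A z) with P z, and inverting \<open>F\<close> shows that
      \<open>Ac\<close> extends this very solution.\<close>
    have zero: "((\<lambda>z. F (of_real (A z)) - Bc (of_real z)) has_vector_derivative 0) (at z within ball z0 e)"
      if "z \<in> ball z0 e" for z
    proof -
      have z: "of_real (A z) \<in> S" "(A has_real_derivative \<beta> z / f (A z)) (at z)"
        "(Bc has_field_derivative of_real (\<beta> z)) (at (of_real z))" "fc (of_real (A z)) \<noteq> 0"
        using loc[of z] that r(2) by (auto simp: dist_commute)
      have "((\<lambda>z. complex_of_real (A z)) has_vector_derivative of_real (\<beta> z / f (A z))) (at z)"
        by (rule has_vector_derivative_of_real[OF z(2)])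
      from field_vector_diff_chain_at[OF this F'[OF z(1)]]
      have 1: "((\<lambda>z. F (of_real (A z))) has_vector_derivative of_real (\<beta> z)) (at z)"
        using z(4) fc_real[OF z(1)] by (simp add: o_def)
      have 2: "((\<lambda>z. Bc (of_real z)) has_vector_derivative of_real (\<beta> z)) (at z)"
        using field_vector_diff_chain_at[OF has_vector_derivative_of_real[OF DERIV_ident] z(3)]
        by (simp add: o_def)
      from has_vector_derivative_diff[OF 1 2] show ?thesis
        by (auto intro: has_vector_derivative_at_within)
    qed
    obtain c where c: "\<And>z. z \<in> ball z0 e \<Longrightarrow> F (of_real (A z)) - Bc (of_real z) = c"
      proof (rule has_vector_derivative_zero_constant[OF convex_ball zero])
      fix c assume "\<And>z. z \<in> ball z0 e \<Longrightarrow> F (of_real (A z)) - Bc (of_real z) = c"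
      then show ?thesis by (rule that)
    qed
    show "\<forall>\<^sub>F z in nhds z0. Ac (of_real z) = of_real (A z)"
      unfolding eventually_nhds_metric
    proof (intro exI[of _ e] conjI e allI impI)
      fix z assume z: "dist z z0 < e"
      then have "F (of_real (A z)) = P (of_real z)"
        using c[of z] c[of z0] e A0 by (simp add: P_def dist_commute algebra_simps)
      then show "Ac (of_real z) = of_real (A z)"
        using g(3)[of "of_real (A z)"] loc[OF z] by (simp add: Ac_def)
    qed
  qed
qed

section \<open>Coefficient recursions\<close>

lemma fps_nth_inverse_recursion:
  fixes a c :: "'a::field fps"
  assumes "a * c = 1" "n > 0"
  shows "fps_nth c n = - (1 / fps_nth a 0) * (\<Sum>i=1..n. fps_nth a i * fps_nth c (n - i))"
proof -
  have "fps_nth a 0 * fps_nth c 0 = 1"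
    using arg_cong[OF assms(1), of "\<lambda>f. fps_nth f 0"] by simp
  then have a0: "fps_nth a 0 \<noteq> 0" by auto
  have "0 = fps_nth (a * c) n" using assms by simp
  also have "\<dots> = fps_nth a 0 * fps_nth c n + (\<Sum>i=1..n. fps_nth a i * fps_nth c (n - i))"
    unfolding fps_mult_nth by (simp add: sum.atLeast_Suc_atMost)
  finally show ?thesis using a0 by (simp add: field_simps add_eq_0_iff)
qed

text \<open>The operator X d/dX multiplies the n-th coefficient by n without shifting it, so the
  differential equation of an exponential becomes a convolution whose term i = 0 vanishes.\<close>

lemma fps_nth_exp_recursion:
  fixes p d :: "'a::field_char_0 fps"
  assumes "fps_deriv d = fps_deriv p * d" "n > 0"
  shows "fps_nth d n = 1 / of_nat n * (\<Sum>i=1..n. of_nat i * fps_nth p i * fps_nth d (n - i))"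
proof -
  have "fps_XD d = fps_XD p * d" by (simp add: fps_XD_def assms(1) mult.assoc)
  then have "of_nat n * fps_nth d n = fps_nth (fps_XD p * d) n" by (metis fps_XD_nth)
  also have "\<dots> = (\<Sum>i=1..n. of_nat i * fps_nth p i * fps_nth d (n - i))"
    unfolding fps_mult_nth by (simp add: sum.atLeast_Suc_atMost)
  finally show ?thesis using assms(2) by (simp add: field_simps)
qed

text \<open>This is J. C. P. Miller's recursion for the powers of a series, read off from the
  differential equation of e = a^r after multiplication by X.\<close>

lemma fps_nth_power_recursion:
  fixes a e :: "'a::field_char_0 fps"
  assumes "a * fps_deriv e = fps_const r * fps_deriv a * e" "n > 0" "fps_nth a 0 \<noteq> 0"
  shows "fps_nth e n = 1 / fps_nth a 0 *
    (\<Sum>i=1..n. ((r + 1) * of_nat i / of_nat n - 1) * fps_nth a i * fps_nth e (n - i))"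
proof -
  have "a * fps_XD e = fps_const r * fps_XD a * e"
    using arg_cong[OF assms(1), of "\<lambda>f. fps_X * f"] by (simp add: fps_XD_def ac_simps)
  then have "fps_nth (a * fps_XD e) n = fps_nth (fps_const r * (fps_XD a * e)) n"
    by (simp add: mult.assoc)
  then have "(\<Sum>i=0..n. fps_nth a i * (of_nat (n - i) * fps_nth e (n - i)))
      = r * (\<Sum>i=0..n. of_nat i * fps_nth a i * fps_nth e (n - i))"
    by (simp only: fps_mult_left_const_nth fps_XD_nth fps_mult_nth[of a] fps_mult_nth[of "fps_XD a"])
  then have "fps_nth a 0 * (of_nat n * fps_nth e n)
      = r * (\<Sum>i=1..n. of_nat i * fps_nth a i * fps_nth e (n - i))
        - (\<Sum>i=1..n. fps_nth a i * (of_nat (n - i) * fps_nth e (n - i)))"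
    by (simp add: sum.atLeast_Suc_atMost eq_diff_eq)
  \<comment> \<open>Termwise this is r i - (n - i) = (r + 1) i - n, with n taken out. For r = 1 -
    \<lambda> it gives the factor 2 - \<lambda>.\<close>
  also have "\<dots> = (\<Sum>i=1..n. of_nat n * (((r + 1) * of_nat i / of_nat n - 1) * fps_nth a i * fps_nth e (n - i)))"
    unfolding sum_distrib_left sum_subtractf[symmetric]
    using assms(2) by (intro sum.cong refl) (simp add: of_nat_diff field_simps)
  also have "\<dots> = of_nat n * (\<Sum>i=1..n. ((r + 1) * of_nat i / of_nat n - 1) * fps_nth a i * fps_nth e (n - i))"
    by (simp add: sum_distrib_left)
  finally show ?thesis using assms(2,3) by (simp add: field_simps)
qed

lemma fps_nth_deriv_eq_imp:
  fixes a f :: "'a::field_char_0 fps"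
  assumes "fps_deriv a = fps_const k * f" "n > 0"
  shows "fps_nth a n = k / of_nat n * fps_nth f (n - 1)"
proof -
  have "of_nat n * fps_nth a n = k * fps_nth f (n - 1)"
    using assms(2) arg_cong[OF assms(1), of "\<lambda>f. fps_nth f (n - 1)"] by simp
  then show ?thesis using assms(2) by (simp add: field_simps)
qed

text \<open>The geometric series of 1 / (z + X). The hypothesis forces z to be non-zero through its
  constant term.\<close>

lemma fps_nth_inverse_linear:
  fixes u :: "'a::field fps"
  assumes "(fps_const z + fps_X) * u = 1"
  shows "fps_nth u k = (-1) ^ k / z ^ (k + 1)"
proof -
  have eq: "fps_const z * u + fps_X * u = 1" using assms by (simp add: distrib_right)
  have u0: "z * fps_nth u 0 = 1" using arg_cong[OF eq, of "\<lambda>f. fps_nth f 0"] by simp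
  then have z: "z \<noteq> 0" by auto
  show ?thesis
  proof (induction k)
    case 0
    then show ?case using u0 z by (simp add: nonzero_eq_divide_eq mult.commute)
  next
    case (Suc k)
    have "z * fps_nth u (Suc k) + fps_nth u k = 0"
      using arg_cong[OF eq, of "\<lambda>f. fps_nth f (Suc k)"] by simp
    then have "fps_nth u (Suc k) = - fps_nth u k / z" using z by (simp add: field_simps add_eq_0_iff)
    then show ?case using Suc z by simp
  qed
qed

section \<open>From analytic germs to formal power series\<close>

lemma fps_expansion_eq_if_eventually_eq:
  fixes F G :: "complex fps"
  assumes "f has_fps_expansion F" "g has_fps_expansion G" "\<forall>\<^sub>F w in nhds 0. f w = g w"
  shows "F = G"
  using assms fps_expansion_unique_complex has_fps_expansion_cong by blast

lemma fps_deriv_expansion_eq: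
  fixes F G :: "complex fps"
  assumes "f has_fps_expansion F" "g has_fps_expansion G"
    and "\<forall>\<^sub>F w in nhds 0. (f has_field_derivative g w) (at w)"
  shows "fps_deriv F = G"
  by (rule fps_expansion_eq_if_eventually_eq[OF has_fps_expansion_deriv[OF assms(1)] assms(2)])
     (use assms(3) in \<open>auto elim!: eventually_mono intro: DERIV_imp_deriv\<close>)

text \<open>The series are the Taylor expansions at 0 of f, 1 / f, the exponential and the power,
  and each relation between them is an identity of germs, transferred by uniqueness of expansions.
  The value f 0 lies off the branch cut of \<open>powr\<close>; as the cut is closed, f avoids it
  near 0, where the power is analytic and obeys the usual derivative rule.\<close>

lemma gig_auxiliary_expansions:
  fixes f :: "complex \<Rightarrow> complex" and s r :: complex
  assumes f: "f analytic_on {0}" "f 0 \<notin> \<real>\<^sub>\<le>\<^sub>0"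
  obtains a c d e where "f has_fps_expansion a"
    "(\<lambda>w. exp (s * (1 / f w + f w))) has_fps_expansion d"
    "(\<lambda>w. f w powr r) has_fps_expansion e"
    "a * c = 1" "fps_deriv d = fps_deriv (fps_const s * (c + a)) * d"
    "a * fps_deriv e = fps_const r * fps_deriv a * e"
    "fps_nth c 0 = 1 / f 0" "fps_nth d 0 = exp (s * (fps_nth c 0 + fps_nth a 0))"
    "fps_nth e 0 = f 0 powr r"
proof -
  have nz: "f 0 \<noteq> 0" using f(2) by auto
  have an: "(\<lambda>w. 1 / f w) analytic_on {0}" "(\<lambda>w. exp (s * (1 / f w + f w))) analytic_on {0}"
    "(\<lambda>w. f w powr r) analytic_on {0}"
    using f nz by (auto intro!: analytic_intros)
  obtain a c d e where ex: "f has_fps_expansion a" "(\<lambda>w. 1 / f w) has_fps_expansion c"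
      "(\<lambda>w. exp (s * (1 / f w + f w))) has_fps_expansion d" "(\<lambda>w. f w powr r) has_fps_expansion e"
    using analytic_at_imp_has_fps_expansion_0[OF f(1)] analytic_at_imp_has_fps_expansion_0[OF an(1)]
      analytic_at_imp_has_fps_expansion_0[OF an(2)] analytic_at_imp_has_fps_expansion_0[OF an(3)] by blast
  have "\<forall>\<^sub>F w in nhds 0. f w \<in> - \<real>\<^sub>\<le>\<^sub>0"
  proof (rule topological_tendstoD)
    show "(f \<longlongrightarrow> f 0) (nhds 0)"
      using analytic_at_imp_isCont[OF f(1)] by (simp add: isCont_def tendsto_at_iff_tendsto_nhds)
  qed (use f(2) in auto)
  then have ev_np: "\<forall>\<^sub>F w in nhds 0. f w \<notin> \<real>\<^sub>\<le>\<^sub>0" by simp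
  then have ev_nz: "\<forall>\<^sub>F w in nhds 0. f w \<noteq> 0" by eventually_elim auto
  obtain T where T: "open T" "0 \<in> T" "f holomorphic_on T" using f(1) by (auto simp: analytic_at)
  have ev_d: "\<forall>\<^sub>F w in nhds 0. (f has_field_derivative deriv f w) (at w)"
    using eventually_nhds_in_open[OF T(1,2)] by eventually_elim (rule holomorphic_derivI[OF T(3,1)])
  have ac: "a * c = 1"
    by (rule fps_expansion_eq_if_eventually_eq[OF has_fps_expansion_mult[OF ex(1,2)] has_fps_expansion_1])
       (use ev_nz in \<open>auto elim!: eventually_mono\<close>)
  have p: "(\<lambda>w. s * (1 / f w + f w)) has_fps_expansion fps_const s * (c + a)"
    by (intro fps_expansion_intros ex)
  have "(\<lambda>w. deriv (\<lambda>w. s * (1 / f w + f w)) w * exp (s * (1 / f w + f w)))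
      has_fps_expansion fps_deriv (fps_const s * (c + a)) * d"
    by (intro has_fps_expansion_mult has_fps_expansion_deriv p ex)
  then have d: "fps_deriv d = fps_deriv (fps_const s * (c + a)) * d"
  proof (rule fps_deriv_expansion_eq[OF ex(3)])
    show "\<forall>\<^sub>F w in nhds 0. ((\<lambda>w. exp (s * (1 / f w + f w))) has_field_derivative
        deriv (\<lambda>w. s * (1 / f w + f w)) w * exp (s * (1 / f w + f w))) (at w)"
      using ev_nz ev_d
    proof eventually_elim
      case (elim w)
      have "(\<lambda>w. s * (1 / f w + f w)) field_differentiable (at w)"
        using elim by (intro derivative_intros) (auto simp: field_differentiable_def)
      then have "((\<lambda>w. s * (1 / f w + f w)) has_field_derivative deriv (\<lambda>w. s * (1 / f w + f w)) w) (at w)"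
        by (simp add: DERIV_deriv_iff_field_differentiable)
      from DERIV_fun_exp[OF this] show ?case by (simp add: mult.commute)
    qed
  qed
  have "(\<lambda>w. f w * deriv (\<lambda>w. f w powr r) w) has_fps_expansion a * fps_deriv e"
    by (intro has_fps_expansion_mult has_fps_expansion_deriv ex)
  moreover have "(\<lambda>w. r * deriv f w * f w powr r) has_fps_expansion fps_const r * fps_deriv a * e"
    by (intro has_fps_expansion_mult has_fps_expansion_deriv has_fps_expansion_const ex)
  moreover have "\<forall>\<^sub>F w in nhds 0. f w * deriv (\<lambda>w. f w powr r) w = r * deriv f w * f w powr r"
    using ev_np ev_d ev_nz
  proof eventually_elim
    case (elim w)
    have "((\<lambda>w. f w powr r) has_field_derivative r * f w powr (r - 1) * deriv f w) (at w)"
      using DERIV_chain2[OF has_field_derivative_powr[OF elim(1), of r] elim(2)] by simp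
    then have "deriv (\<lambda>w. f w powr r) w = r * f w powr (r - 1) * deriv f w" by (rule DERIV_imp_deriv)
    then show ?case using elim(3) by (simp add: powr_diff)
  qed
  ultimately have e: "a * fps_deriv e = fps_const r * fps_deriv a * e"
    by (rule fps_expansion_eq_if_eventually_eq)
  note nth0 = ex[THEN has_fps_expansion_imp_0_eq_fps_nth_0]
  show thesis
    by (rule that[OF ex(1,3,4) ac d e]) (simp_all add: nth0[symmetric])
qed

text \<open>The common core of both problems, which differ only in the base distribution function
  \<open>Bc\<close>; as only its derivative enters, \<open>Bc\<close> matters up to an additive
  constant. The reciprocal density contributes 2 K, the exponential series d and the power series
  e.\<close>

lemma gig_ivp_expansion:
  fixes A \<beta> :: "real \<Rightarrow> real" and Bc :: "complex \<Rightarrow> complex" and B :: "complex fps"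
  assumes \<omega>: "\<omega> > 0"
    and Bc: "Bc analytic_on {complex_of_real z0}"
    and Bc_real: "\<forall>\<^sub>F z in nhds z0. deriv Bc (of_real z) = of_real (\<beta> z)"
    and B: "(\<lambda>w. Bc (of_real z0 + w)) has_fps_expansion B"
    and A0: "A z0 = x0" "x0 > 0"
    and A': "\<forall>\<^sub>F z in nhds z0. (A has_real_derivative \<beta> z / gig_pdf l \<omega> (A z)) (at z)"
  obtains a c d e :: "complex fps" where
    "\<forall>\<^sub>F z in nhds z0. (\<lambda>n. fps_nth a n * of_real ((z - z0) ^ n)) sums of_real (A z)"
    "fps_nth a 0 = of_real x0"
    "fps_deriv a = fps_const (of_real (2 * besselK l \<omega>)) * (fps_deriv B * (d * e))"
    "a * c = 1" "fps_nth c 0 = of_real (1 / x0)"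
    "fps_deriv d = fps_deriv (fps_const (of_real (\<omega> / 2)) * (c + a)) * d"
    "fps_nth d 0 = of_real (exp (\<omega> * (1 / x0 + x0) / 2))"
    "a * fps_deriv e = fps_const (of_real (1 - l)) * fps_deriv a * e"
    "fps_nth e 0 = of_real (x0 powr (1 - l))"
proof -
  let ?z0 = "complex_of_real z0"
  let ?K = "complex_of_real (2 * besselK l \<omega>)"
  let ?s = "complex_of_real (\<omega> / 2)"
  \<comment> \<open>The right half-plane is convex, so the density has a primitive there, and it
    avoids both the pole of 1 / w and the branch cut of \<open>powr\<close>.\<close>
  define S where "S = {w :: complex. Re w > 0}"
  define fc where "fc w = 1 / ?K * (w powr (of_real (l - 1)) * exp (- ?s * (1 / w + w)))" for w
  have K: "?K \<noteq> 0" using besselK_pos[OF \<omega>, of l] by simp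
  have S: "open S" "convex S"
    unfolding S_def by (rule open_halfspace_Re_gt, rule convex_halfspace_Re_gt)
  have S_np: "w \<notin> \<real>\<^sub>\<le>\<^sub>0" "w \<noteq> 0" if "w \<in> S" for w
    using that by (auto simp: S_def elim!: nonpos_Reals_cases)
  have fc: "fc holomorphic_on S" unfolding fc_def[abs_def]
    using S_np K by (intro holomorphic_intros) auto
  have fc_real: "fc (of_real x) = of_real (gig_pdf l \<omega> x)" if "of_real x \<in> S" for x
  proof -
    have x: "x > 0" using that by (simp add: S_def)
    have "exp (- ?s * (1 / of_real x + of_real x)) = of_real (exp (- (\<omega> / 2) * (1 / x + x)))"
      by (simp flip: exp_of_real)
    then show ?thesis using x
      by (simp add: fc_def gig_pdf_def powr_of_real del: of_real_diff)
  qed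
  have inv_fc: "1 / fc w = ?K * (exp (?s * (1 / w + w)) * w powr of_real (1 - l))" if "w \<in> S" for w
  proof -
    have "w powr of_real (1 - l) = 1 / w powr of_real (l - 1)"
      using powr_minus_divide[of w "of_real (l - 1)"] by simp
    then show ?thesis using K by (simp add: fc_def exp_minus field_simps)
  qed
  have x0: "of_real x0 \<in> S" using A0 by (simp add: S_def)
  have "gig_pdf l \<omega> x0 \<noteq> 0" using gig_pdf_pos[OF \<omega> A0(2), of l] by simp
  then have fc_x0: "fc (of_real x0) \<noteq> 0" unfolding fc_real[OF x0] by simp
  obtain Ac where Ac: "Ac analytic_on {?z0}" "Ac ?z0 = of_real x0"
    "\<forall>\<^sub>F z in nhds z0. Ac (of_real z) = of_real (A z)"
    "\<forall>\<^sub>F w in nhds ?z0. (Ac has_field_derivative deriv Bc w / fc (Ac w)) (at w)"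
    by (rule separable_ivp_holomorphic_extension[OF S x0 fc fc_x0 fc_real Bc Bc_real A0(1) A'])
  define f where "f w = Ac (?z0 + w)" for w
  have shift: "filterlim (\<lambda>w. ?z0 + w) (nhds ?z0) (nhds 0)"
    by (rule tendsto_eq_intros filterlim_ident refl)+ simp
  have f0: "f 0 = of_real x0" by (simp add: f_def Ac)
  have f_an: "f analytic_on {0}"
    unfolding f_def[abs_def]
    by (rule analytic_on_compose_gen[of "\<lambda>w. ?z0 + w" "{0}" Ac "{?z0}", unfolded o_def])
       (use Ac(1) in \<open>auto intro!: analytic_intros\<close>)
  have f0_np: "f 0 \<notin> \<real>\<^sub>\<le>\<^sub>0" using S_np(1)[OF x0] by (simp add: f0)
  obtain a c d e where ex: "f has_fps_expansion a"
    "(\<lambda>w. exp (?s * (1 / f w + f w))) has_fps_expansion d"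
    "(\<lambda>w. f w powr of_real (1 - l)) has_fps_expansion e"
    and rel: "a * c = 1" "fps_deriv d = fps_deriv (fps_const ?s * (c + a)) * d"
    "a * fps_deriv e = fps_const (of_real (1 - l)) * fps_deriv a * e"
    and ini: "fps_nth c 0 = 1 / f 0" "fps_nth d 0 = exp (?s * (fps_nth c 0 + fps_nth a 0))"
    "fps_nth e 0 = f 0 powr of_real (1 - l)"
    by (rule gig_auxiliary_expansions[OF f_an f0_np, of ?s "of_real (1 - l)"])
  have a0: "fps_nth a 0 = of_real x0"
    using has_fps_expansion_imp_0_eq_fps_nth_0[OF ex(1)] f0 by simp
  have f_in: "\<forall>\<^sub>F w in nhds 0. f w \<in> S"
  proof (rule topological_tendstoD[OF _ S(1)])
    show "(f \<longlongrightarrow> f 0) (nhds 0)"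
      using analytic_at_imp_isCont[OF f_an] by (simp add: isCont_def tendsto_at_iff_tendsto_nhds)
  qed (use x0 f0 in simp)
  have deriv_shift: "deriv (\<lambda>w. Bc (?z0 + w)) w = deriv Bc (?z0 + w)" for w
    unfolding deriv_def using DERIV_shift[of Bc _ w ?z0] by (simp add: add.commute)
  have "\<forall>\<^sub>F w in nhds 0. (Ac has_field_derivative deriv Bc (?z0 + w) / fc (Ac (?z0 + w))) (at (?z0 + w))"
    by (rule eventually_compose_filterlim[OF Ac(4) shift])
  then have ev: "\<forall>\<^sub>F w in nhds 0. (f has_field_derivative ?K * (deriv (\<lambda>w. Bc (?z0 + w)) w *
      (exp (?s * (1 / f w + f w)) * f w powr of_real (1 - l)))) (at w)"
    using f_in
  proof eventually_elim
    case (elim w)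
    have "(f has_field_derivative deriv Bc (?z0 + w) * (1 / fc (f w))) (at w)"
      using elim(1) DERIV_shift[of Ac _ w ?z0] by (simp add: f_def[abs_def] add.commute)
    then show ?case
      unfolding inv_fc[OF elim(2)] deriv_shift by (simp only: ac_simps)
  qed
  have a': "fps_deriv a = fps_const ?K * (fps_deriv B * (d * e))"
    by (rule fps_deriv_expansion_eq[OF ex(1) _ ev])
       (intro has_fps_expansion_mult has_fps_expansion_const has_fps_expansion_deriv B ex)
  \<comment> \<open>The expansion of an analytic germ has a positive radius of convergence;
    convergence of the recursively defined series is inherited from here.\<close>
  have conv: "\<forall>\<^sub>F z in nhds z0. (\<lambda>n. fps_nth a n * of_real ((z - z0) ^ n)) sums of_real (A z)"
  proof -
    have "\<forall>\<^sub>F w in nhds 0. (\<lambda>n. fps_nth a n * w ^ n) sums f w"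
    proof -
      have r: "fps_conv_radius a > 0" "\<forall>\<^sub>F w in nhds 0. eval_fps a w = f w"
        using ex(1) by (auto simp: has_fps_expansion_def)
      have "\<forall>\<^sub>F w in nhds 0. w \<in> eball 0 (fps_conv_radius a)"
        using r(1) by (intro eventually_nhds_in_open) (auto simp: zero_ereal_def)
      then show ?thesis using r(2)
      proof eventually_elim
        case (elim w)
        then show ?case using sums_eval_fps[of w a] by simp
      qed
    qed
    moreover have "filterlim (\<lambda>z. complex_of_real (z - z0)) (nhds 0) (nhds z0)"
    proof -
      have "((\<lambda>z. complex_of_real (z - z0)) \<longlongrightarrow> of_real (z0 - z0)) (nhds z0)"
        by (intro tendsto_of_real tendsto_diff filterlim_ident tendsto_const)
      then show ?thesis by simp
    qed
    ultimately have "\<forall>\<^sub>F z in nhds z0. (\<lambda>n. fps_nth a n * complex_of_real (z - z0) ^ n) sums f (of_real (z - z0))"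
      by (rule eventually_compose_filterlim)
    then show ?thesis using Ac(3)
      by eventually_elim (simp add: f_def)
  qed
  have c0: "fps_nth c 0 = of_real (1 / x0)" by (simp add: ini f0)
  have "?s * (fps_nth c 0 + fps_nth a 0) = of_real (\<omega> * (1 / x0 + x0) / 2)"
    by (simp add: c0 a0)
  then have d0: "fps_nth d 0 = of_real (exp (\<omega> * (1 / x0 + x0) / 2))"
    unfolding ini(2) by (simp only: exp_of_real)
  have e0: "fps_nth e 0 = of_real (x0 powr (1 - l))"
    unfolding ini(3) f0 using A0(2) by (intro powr_of_real) simp
  show thesis
    by (rule that[OF conv a0 a' rel(1) c0 rel(2) d0 rel(3) e0])
qed

section \<open>Agreement of the formal coefficients with the real recursions\<close>

lemma fps_nth_eq_left_b:
  fixes b u :: "complex fps"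
  assumes u: "(fps_const (of_real z0) + fps_X) * u = 1"
    and b': "fps_deriv b = fps_const (of_real (\<omega> / 2)) * (- fps_deriv u * b)"
    and b0: "fps_nth b 0 = of_real (exp (- (\<omega> / (2 * z0))))"
  shows "fps_nth b n = of_real (left_b \<omega> z0 n)"
proof (induction n rule: less_induct)
  case (less n)
  show ?case
  proof (cases "n = 0")
    case True
    then show ?thesis by (simp add: b0 left_b.simps)
  next
    case False
    have "fps_nth b n = of_real (\<omega> / 2) / of_nat n * fps_nth (- fps_deriv u * b) (n - 1)"
      using fps_nth_deriv_eq_imp[OF b'] False by simp
    also have "fps_nth (- fps_deriv u * b) (n - 1) = (\<Sum>k<n. fps_nth (- fps_deriv u) k * fps_nth b (n - k - 1))"
      unfolding fps_mult_nth using False by (intro sum.cong) (auto simp: diff_commute)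
    also have "\<dots> = (\<Sum>k<n. of_real ((-1) ^ k * (real (k + 1) / z0 ^ (k + 2)) * left_b \<omega> z0 (n - k - 1)))"
    proof (intro sum.cong refl)
      fix k assume "k \<in> {..<n}"
      then have "fps_nth b (n - k - 1) = of_real (left_b \<omega> z0 (n - k - 1))" by (intro less) auto
      \<comment> \<open>u is the series of 1 / (z0 + X), so - u' is that of 1 / (z0 + X)^2. Its k-th
        coefficient is - (k + 1) times the coefficient of u at k + 1, which accounts for the sign
        and for the exponent k + 2.\<close>
      moreover have "fps_nth (- fps_deriv u) k = of_real ((-1) ^ k * (real (k + 1) / z0 ^ (k + 2)))"
        using fps_nth_inverse_linear[OF u, of "Suc k"] by simp
      ultimately show "fps_nth (- fps_deriv u) k * fps_nth b (n - k - 1)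
          = of_real ((-1) ^ k * (real (k + 1) / z0 ^ (k + 2)) * left_b \<omega> z0 (n - k - 1))"
        by (simp only: of_real_mult)
    qed
    finally show ?thesis
      using False by (subst left_b.simps) (simp only: of_real_mult of_real_sum of_real_divide of_real_of_nat_eq if_False, simp)
  qed
qed

text \<open>One strong induction serves all four sequences. Inside a step the order a, c, d, e is
  forced: a_n uses d and e only below n, c_n needs a_n, d_n needs a_n and c_n, and e_n needs
  a_n.\<close>

lemma fps_nth_eq_left_a:
  fixes a b c d e :: "complex fps"
  assumes x0: "x0 > 0"
    and b: "\<And>n. fps_nth b n = of_real (left_b \<omega> z0 n)"
    and a: "fps_nth a 0 = of_real x0"
      "fps_deriv a = fps_const (of_real (2 * p_left l \<omega> * besselK l \<omega>)) * (fps_deriv b * (d * e))"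
    and c: "a * c = 1" "fps_nth c 0 = of_real (1 / x0)"
    and d: "fps_deriv d = fps_deriv (fps_const (of_real (\<omega> / 2)) * (c + a)) * d"
      "fps_nth d 0 = of_real (exp (\<omega> * (1 / x0 + x0) / 2))"
    and e: "a * fps_deriv e = fps_const (of_real (1 - l)) * fps_deriv a * e"
      "fps_nth e 0 = of_real (x0 powr (1 - l))"
  shows "fps_nth a n = of_real (left_a l \<omega> z0 x0 n)"
proof -
  let ?a = "left_a l \<omega> z0 x0" and ?c = "left_c l \<omega> z0 x0"
  let ?d = "left_d l \<omega> z0 x0" and ?e = "left_e l \<omega> z0 x0"
  have a00: "?a 0 = x0" by (simp add: left_a.simps)
  have a0: "fps_nth a 0 \<noteq> 0" using x0 a(1) by simp
  have "fps_nth a n = of_real (?a n) \<and> fps_nth c n = of_real (?c n) \<and>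
      fps_nth d n = of_real (?d n) \<and> fps_nth e n = of_real (?e n)"
  proof (induction n rule: less_induct)
    case (less n)
    show ?case
    proof (cases "n = 0")
      case True
      then show ?thesis
        using a c d e by (simp add: left_a.simps[of _ _ _ _ 0] left_c.simps[of _ _ _ _ 0]
            left_d.simps[of _ _ _ _ 0] left_e.simps[of _ _ _ _ 0])
    next
      case False
      then have n: "n > 0" by simp
      have an: "fps_nth a n = of_real (?a n)"
      proof -
        \<comment> \<open>The outer index belongs to b', with k-th coefficient (k + 1) b_(k+1). The
          total degree is n - 1, so the induction hypothesis covers every d and e that
          occurs.\<close>
        have "fps_nth (fps_deriv b * (d * e)) (n - 1)
            = (\<Sum>k<n. \<Sum>j<n - k. of_nat (k + 1) * fps_nth b (k + 1) * fps_nth d j * fps_nth e (n - k - j - 1))"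
          unfolding fps_mult_nth sum_distrib_left using n
          by (intro sum.cong) (auto simp: mult.assoc diff_commute intro!: arg_cong[where f = "fps_nth e"])
        also have "\<dots> = (\<Sum>k<n. \<Sum>j<n - k. of_real (real (k + 1) * left_b \<omega> z0 (k + 1) * ?d j * ?e (n - k - j - 1)))"
          using less.IH by (intro sum.cong refl) (auto simp: b)
        finally show ?thesis
          using fps_nth_deriv_eq_imp[OF a(2) n] n
          by (subst left_a.simps) simp
      qed
      have cn: "fps_nth c n = of_real (?c n)"
      proof -
        have "(\<Sum>i=1..n. fps_nth a i * fps_nth c (n - i)) = (\<Sum>i=1..n. of_real (?a i * ?c (n - i)))"
        proof (intro sum.cong refl)
          fix i assume "i \<in> {1..n}"
          then show "fps_nth a i * fps_nth c (n - i) = of_real (?a i * ?c (n - i))"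
            \<comment> \<open>The term i = n contains a_n itself, available as \<open>an\<close>,
              next to c_0 from the induction hypothesis.\<close>
            using less.IH[of i] less.IH[of "n - i"] an by (cases "i = n") auto
        qed
        then show ?thesis
          using fps_nth_inverse_recursion[OF c(1) n] n a(1)
          by (subst left_c.simps) (simp add: a00)
      qed
      have dn: "fps_nth d n = of_real (?d n)"
      proof -
        have "fps_nth d n = 1 / of_nat n * (\<Sum>i=1..n. of_nat i * fps_nth (fps_const (of_real (\<omega> / 2)) * (c + a)) i * fps_nth d (n - i))"
          by (rule fps_nth_exp_recursion[OF d(1) n])
        also have "(\<Sum>i=1..n. of_nat i * fps_nth (fps_const (of_real (\<omega> / 2)) * (c + a)) i * fps_nth d (n - i))
            = (\<Sum>i=1..n. of_real (\<omega> / 2 * (real i * (?c i + ?a i) * ?d (n - i))))"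
        proof (intro sum.cong refl)
          fix i assume "i \<in> {1..n}"
          then have "fps_nth a i = of_real (?a i)" "fps_nth c i = of_real (?c i)" "fps_nth d (n - i) = of_real (?d (n - i))"
            using less.IH[of i] less.IH[of "n - i"] an cn by (cases "i = n"; auto)+
          then show "of_nat i * fps_nth (fps_const (of_real (\<omega> / 2)) * (c + a)) i * fps_nth d (n - i)
              = of_real (\<omega> / 2 * (real i * (?c i + ?a i) * ?d (n - i)))" by simp
        qed
        finally show ?thesis
          using n by (subst left_d.simps) (simp add: sum_distrib_left[symmetric] flip: sum_divide_distrib)
      qed
      have "fps_nth e n = of_real (?e n)"
      proof -
        have "fps_nth e n = 1 / fps_nth a 0 * (\<Sum>i=1..n. ((of_real (1 - l) + 1) * of_nat i / of_nat n - 1) * fps_nth a i * fps_nth e (n - i))"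
          by (rule fps_nth_power_recursion[OF e(1) n a0])
        also have "(\<Sum>i=1..n. ((of_real (1 - l) + 1) * of_nat i / of_nat n - 1) * fps_nth a i * fps_nth e (n - i))
            = (\<Sum>i=1..n. of_real (((2 - l) * real i / real n - 1) * ?a i * ?e (n - i)))"
        proof (intro sum.cong refl)
          fix i assume "i \<in> {1..n}"
          then have "fps_nth a i = of_real (?a i)" "fps_nth e (n - i) = of_real (?e (n - i))"
            using less.IH[of i] less.IH[of "n - i"] an by (cases "i = n"; auto)+
          then show "((of_real (1 - l) + 1) * of_nat i / of_nat n - 1) * fps_nth a i * fps_nth e (n - i)
              = of_real (((2 - l) * real i / real n - 1) * ?a i * ?e (n - i))" by simp
        qed
        finally show ?thesis
          using n a(1) by (subst left_e.simps) (simp add: a00)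
      qed
      with an cn dn show ?thesis by simp
    qed
  qed
  then show ?thesis by simp
qed

text \<open>Here d also absorbs exp (- \<omega> z / 2). Splitting z = z0 + X, the part X alters the
  exponent only at degree 1, which is the exceptional case of \<open>right_b\<close>, while the part
  z0 is a constant that appears only in d_0. The exponent series needs no induction claim of its
  own, since b_i is given by a_i and c_i.\<close>

lemma fps_nth_eq_right_a:
  fixes a c d e :: "complex fps"
  assumes x0: "x0 > 0"
    and a: "fps_nth a 0 = of_real x0"
      "fps_deriv a = fps_const (of_real (\<omega> * p_right l \<omega> * besselK l \<omega>)) * (d * e)"
    and c: "a * c = 1" "fps_nth c 0 = of_real (1 / x0)"
    and d: "fps_deriv d = fps_deriv (fps_const (of_real (\<omega> / 2)) * (c + a - fps_X)) * d"
      "fps_nth d 0 = of_real (exp (\<omega> / 2 * (1 / x0 + x0) - \<omega> * z0 / 2))"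
    and e: "a * fps_deriv e = fps_const (of_real (1 - l)) * fps_deriv a * e"
      "fps_nth e 0 = of_real (x0 powr (1 - l))"
  shows "fps_nth a n = of_real (right_a l \<omega> z0 x0 n)"
proof -
  let ?a = "right_a l \<omega> z0 x0" and ?b = "right_b l \<omega> z0 x0" and ?c = "right_c l \<omega> z0 x0"
  let ?d = "right_d l \<omega> z0 x0" and ?e = "right_e l \<omega> z0 x0"
  have a00: "?a 0 = x0" by (simp add: right_a.simps)
  have a0: "fps_nth a 0 \<noteq> 0" using x0 a(1) by simp
  have "fps_nth a n = of_real (?a n) \<and> fps_nth c n = of_real (?c n) \<and>
      fps_nth d n = of_real (?d n) \<and> fps_nth e n = of_real (?e n)"
  proof (induction n rule: less_induct)
    case (less n)
    show ?case
    proof (cases "n = 0")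
      case True
      then show ?thesis
        using a c d e by (simp add: right_a.simps[of _ _ _ _ 0] right_b.simps[of _ _ _ _ 0] right_c.simps[of _ _ _ _ 0]
            right_d.simps[of _ _ _ _ 0] right_e.simps[of _ _ _ _ 0])
    next
      case False
      then have n: "n > 0" by simp
      have an: "fps_nth a n = of_real (?a n)"
      proof -
        have "fps_nth (d * e) (n - 1) = (\<Sum>k<n. fps_nth d k * fps_nth e (n - k - 1))"
          unfolding fps_mult_nth using n
          by (intro sum.cong) (auto simp: diff_commute)
        also have "\<dots> = (\<Sum>k<n. of_real (?d k * ?e (n - k - 1)))"
          using less.IH by (intro sum.cong refl) auto
        finally show ?thesis
          using fps_nth_deriv_eq_imp[OF a(2) n] n
          by (subst right_a.simps) simp
      qed
      have cn: "fps_nth c n = of_real (?c n)"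
      proof -
        have "(\<Sum>i=1..n. fps_nth a i * fps_nth c (n - i)) = (\<Sum>i=1..n. of_real (?a i * ?c (n - i)))"
        proof (intro sum.cong refl)
          fix i assume "i \<in> {1..n}"
          then show "fps_nth a i * fps_nth c (n - i) = of_real (?a i * ?c (n - i))"
            using less.IH[of i] less.IH[of "n - i"] an by (cases "i = n") auto
        qed
        then show ?thesis
          using fps_nth_inverse_recursion[OF c(1) n] n a(1)
          by (subst right_c.simps) (simp add: a00)
      qed
      have dn: "fps_nth d n = of_real (?d n)"
      proof -
        have "fps_nth d n = 1 / of_nat n * (\<Sum>i=1..n. of_nat i * fps_nth (fps_const (of_real (\<omega> / 2)) * (c + a - fps_X)) i * fps_nth d (n - i))"
          by (rule fps_nth_exp_recursion[OF d(1) n])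
        also have "(\<Sum>i=1..n. of_nat i * fps_nth (fps_const (of_real (\<omega> / 2)) * (c + a - fps_X)) i * fps_nth d (n - i))
            = (\<Sum>i=1..n. of_real (real i * ?b i * ?d (n - i)))"
        proof (intro sum.cong refl)
          fix i assume i: "i \<in> {1..n}"
          then have eqs: "fps_nth a i = of_real (?a i)" "fps_nth c i = of_real (?c i)" "fps_nth d (n - i) = of_real (?d (n - i))"
            using less.IH[of i] less.IH[of "n - i"] an cn by (cases "i = n"; auto)+
          have "fps_nth (fps_const (of_real (\<omega> / 2)) * (c + a - fps_X)) i = of_real (?b i)"
            using i eqs by (cases "i = 1") (auto simp: right_b.simps[of _ _ _ _ i] right_b.simps[of _ _ _ _ "Suc 0"])
          then show "of_nat i * fps_nth (fps_const (of_real (\<omega> / 2)) * (c + a - fps_X)) i * fps_nth d (n - i)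
              = of_real (real i * ?b i * ?d (n - i))" by (simp only: eqs of_real_mult of_real_of_nat_eq)
        qed
        finally show ?thesis
          using n by (subst right_d.simps) simp
      qed
      have "fps_nth e n = of_real (?e n)"
      proof -
        have "fps_nth e n = 1 / fps_nth a 0 * (\<Sum>i=1..n. ((of_real (1 - l) + 1) * of_nat i / of_nat n - 1) * fps_nth a i * fps_nth e (n - i))"
          by (rule fps_nth_power_recursion[OF e(1) n a0])
        also have "(\<Sum>i=1..n. ((of_real (1 - l) + 1) * of_nat i / of_nat n - 1) * fps_nth a i * fps_nth e (n - i))
            = (\<Sum>i=1..n. of_real (((2 - l) * real i / real n - 1) * ?a i * ?e (n - i)))"
        proof (intro sum.cong refl)
          fix i assume "i \<in> {1..n}"
          then have "fps_nth a i = of_real (?a i)" "fps_nth e (n - i) = of_real (?e (n - i))"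
            using less.IH[of i] less.IH[of "n - i"] an by (cases "i = n"; auto)+
          then show "((of_real (1 - l) + 1) * of_nat i / of_nat n - 1) * fps_nth a i * fps_nth e (n - i)
              = of_real (((2 - l) * real i / real n - 1) * ?a i * ?e (n - i))" by simp
        qed
        finally show ?thesis
          using n a(1) by (subst right_e.simps) (simp add: a00)
      qed
      with an cn dn show ?thesis by simp
    qed
  qed
  then show ?thesis by simp
qed

section \<open>The left and right problems\<close>

text \<open>The base distribution function p_L exp (- \<omega> / (2 z)) is put into the common core.
  The series b expands the exponential alone; the factor p_L is moved into the constant in front of
  the double sum.\<close>

lemma left_series_expansion:
  fixes A :: "real \<Rightarrow> real"
  assumes \<omega>: "\<omega> > 0" and z0: "z0 > 0" and A0: "A z0 = x0" "x0 > 0"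
    and A': "\<forall>\<^sub>F z in nhds z0. (A has_real_derivative
        p_left l \<omega> * (\<omega> / (2 * z\<^sup>2)) * exp (- (\<omega> / (2 * z))) / gig_pdf l \<omega> (A z)) (at z)"
  shows "\<forall>\<^sub>F z in nhds z0. (\<lambda>n. left_a l \<omega> z0 x0 n * (z - z0) ^ n) sums A z"
proof -
  let ?z0 = "complex_of_real z0" and ?s = "complex_of_real (\<omega> / 2)" and ?p = "complex_of_real (p_left l \<omega>)"
  define Bc where "Bc w = ?p * exp (- ?s * (1 / w))" for w
  have z0_nz: "?z0 \<noteq> 0" using z0 by simp
  have Bc_an: "Bc analytic_on {?z0}"
    unfolding Bc_def[abs_def] using z0_nz by (auto intro!: analytic_intros)
  have Bc_real: "\<forall>\<^sub>F z in nhds z0. deriv Bc (of_real z)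
      = of_real (p_left l \<omega> * (\<omega> / (2 * z\<^sup>2)) * exp (- (\<omega> / (2 * z))))"
  proof -
    have "\<forall>\<^sub>F z in nhds z0. z \<in> {0<..}" using z0 by (intro eventually_nhds_in_open) auto
    then show ?thesis
    proof eventually_elim
      case (elim z)
      have "exp (- (of_real \<omega> / (2 * complex_of_real z))) = of_real (exp (- (\<omega> / (2 * z))))"
        by (simp flip: exp_of_real)
      moreover have "(Bc has_field_derivative ?p * (of_real \<omega> / (2 * (of_real z)\<^sup>2)) * exp (- (of_real \<omega> / (2 * of_real z)))) (at (of_real z))"
        unfolding Bc_def[abs_def] using elim
        by (auto intro!: derivative_eq_intros simp: power2_eq_square)
      ultimately show ?case by (simp add: DERIV_imp_deriv)
    qed
  qed
  have an: "(\<lambda>w. 1 / (?z0 + w)) analytic_on {0}" "(\<lambda>w. exp (- ?s * (1 / (?z0 + w)))) analytic_on {0}"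
    using z0_nz by (auto intro!: analytic_intros)
  obtain u b where u: "(\<lambda>w. 1 / (?z0 + w)) has_fps_expansion u"
    and b: "(\<lambda>w. exp (- ?s * (1 / (?z0 + w)))) has_fps_expansion b"
    using an[THEN analytic_at_imp_has_fps_expansion_0] by blast
  have nz: "\<forall>\<^sub>F w in nhds 0. ?z0 + w \<noteq> 0"
  proof -
    have "\<forall>\<^sub>F w in nhds 0. w \<in> - {- ?z0}"
      using z0_nz by (intro eventually_nhds_in_open) (auto simp: neg_equal_0_iff_equal)
    then show ?thesis by eventually_elim (auto simp: add_eq_0_iff)
  qed
  have u_eq: "(fps_const ?z0 + fps_X) * u = 1"
  proof (rule fps_expansion_eq_if_eventually_eq)
    show "(\<lambda>w. (?z0 + w) * (1 / (?z0 + w))) has_fps_expansion (fps_const ?z0 + fps_X) * u"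
      by (intro has_fps_expansion_mult has_fps_expansion_add has_fps_expansion_const has_fps_expansion_fps_X u)
    show "\<forall>\<^sub>F w in nhds 0. (?z0 + w) * (1 / (?z0 + w)) = 1"
      using nz by eventually_elim simp
  qed (rule has_fps_expansion_1)
  \<comment> \<open>b is the exponential of - (\<omega> / 2) u, and - u' carries the factor 1 / z^2
    of the equation, so b' is the whole z-dependent part of the right-hand side apart from
    p_L.\<close>
  have b_eq: "fps_deriv b = fps_const ?s * (- fps_deriv u * b)"
  proof (rule fps_deriv_expansion_eq[OF b])
    show "(\<lambda>w. ?s * (- deriv (\<lambda>w. 1 / (?z0 + w)) w * exp (- ?s * (1 / (?z0 + w)))))
        has_fps_expansion fps_const ?s * (- fps_deriv u * b)"
      by (intro has_fps_expansion_mult has_fps_expansion_minus has_fps_expansion_deriv has_fps_expansion_const u b)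
    show "\<forall>\<^sub>F w in nhds 0. ((\<lambda>w. exp (- ?s * (1 / (?z0 + w)))) has_field_derivative
        ?s * (- deriv (\<lambda>w. 1 / (?z0 + w)) w * exp (- ?s * (1 / (?z0 + w))))) (at w)"
      using nz
    proof eventually_elim
      case (elim w)
      then have "(\<lambda>w. 1 / (?z0 + w)) field_differentiable (at w)"
        by (auto intro!: derivative_intros)
      then have "((\<lambda>w. 1 / (?z0 + w)) has_field_derivative deriv (\<lambda>w. 1 / (?z0 + w)) w) (at w)"
        by (simp add: DERIV_deriv_iff_field_differentiable)
      from DERIV_fun_exp[OF DERIV_cmult[OF this, of "- ?s"]] show ?case by (simp add: ac_simps)
    qed
  qed
  have b0: "fps_nth b 0 = of_real (exp (- (\<omega> / (2 * z0))))"
    using has_fps_expansion_imp_0_eq_fps_nth_0[OF b] by (simp flip: exp_of_real)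
  have B: "(\<lambda>w. Bc (?z0 + w)) has_fps_expansion fps_const ?p * b"
    unfolding Bc_def by (intro has_fps_expansion_mult has_fps_expansion_const b)
  obtain a c d e :: "complex fps" where
    conv: "\<forall>\<^sub>F z in nhds z0. (\<lambda>n. fps_nth a n * of_real ((z - z0) ^ n)) sums of_real (A z)"
    and a0: "fps_nth a 0 = of_real x0"
    and a': "fps_deriv a = fps_const (of_real (2 * besselK l \<omega>)) * (fps_deriv (fps_const ?p * b) * (d * e))"
    and rel: "a * c = 1" "fps_nth c 0 = of_real (1 / x0)"
      "fps_deriv d = fps_deriv (fps_const ?s * (c + a)) * d"
      "fps_nth d 0 = of_real (exp (\<omega> * (1 / x0 + x0) / 2))"
      "a * fps_deriv e = fps_const (of_real (1 - l)) * fps_deriv a * e"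
      "fps_nth e 0 = of_real (x0 powr (1 - l))"
    by (rule gig_ivp_expansion[OF \<omega> Bc_an Bc_real B A0 A'])
  have a'': "fps_deriv a = fps_const (of_real (2 * p_left l \<omega> * besselK l \<omega>)) * (fps_deriv b * (d * e))"
    unfolding a' by (simp add: fps_const_mult[symmetric] ac_simps del: fps_const_mult)
  have "fps_nth a n = of_real (left_a l \<omega> z0 x0 n)" for n
    by (rule fps_nth_eq_left_a[OF A0(2) fps_nth_eq_left_b[OF u_eq b_eq b0] a0 a'' rel])
  then show ?thesis
    using conv by (simp only: of_real_mult[symmetric] sums_of_real_iff)
qed

text \<open>The common core keeps the exponential in A (series d) apart from exp (- \<omega> z / 2)
  (series q), whereas the recursion has a single exponential. The product d * q takes its place: it
  satisfies the differential equation with exponent c + a - X.\<close>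

lemma right_series_expansion:
  fixes A :: "real \<Rightarrow> real"
  assumes \<omega>: "\<omega> > 0" and A0: "A z0 = x0" "x0 > 0"
    and A': "\<forall>\<^sub>F z in nhds z0. (A has_real_derivative
        p_right l \<omega> * (\<omega> / 2) * exp (- (\<omega> / 2 * z)) / gig_pdf l \<omega> (A z)) (at z)"
  shows "\<forall>\<^sub>F z in nhds z0. (\<lambda>n. right_a l \<omega> z0 x0 n * (z - z0) ^ n) sums A z"
proof -
  let ?z0 = "complex_of_real z0" and ?s = "complex_of_real (\<omega> / 2)" and ?p = "complex_of_real (p_right l \<omega>)"
  \<comment> \<open>The base distribution function beyond the mode is 1 plus this; the summand 1
    disappears in the derivative.\<close>
  define Bc where "Bc w = - ?p * exp (- ?s * w)" for w
  have Bc_an: "Bc analytic_on {?z0}"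
    unfolding Bc_def[abs_def] by (auto intro!: analytic_intros)
  have Bc_real: "\<forall>\<^sub>F z in nhds z0. deriv Bc (of_real z) = of_real (p_right l \<omega> * (\<omega> / 2) * exp (- (\<omega> / 2 * z)))"
  proof (rule always_eventually, rule allI)
    fix z
    have "exp (- (?s * of_real z)) = of_real (exp (- (\<omega> / 2 * z)))"
      by (simp flip: exp_of_real)
    moreover have "(Bc has_field_derivative ?p * ?s * exp (- (?s * of_real z))) (at (of_real z))"
      unfolding Bc_def[abs_def] by (auto intro!: derivative_eq_intros)
    ultimately show "deriv Bc (of_real z) = of_real (p_right l \<omega> * (\<omega> / 2) * exp (- (\<omega> / 2 * z)))"
      by (simp only: DERIV_imp_deriv of_real_mult)
  qed
  have "(\<lambda>w. exp (- ?s * (?z0 + w))) analytic_on {0}" by (auto intro!: analytic_intros)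
  then obtain q where q: "(\<lambda>w. exp (- ?s * (?z0 + w))) has_fps_expansion q"
    using analytic_at_imp_has_fps_expansion_0 by blast
  have q_eq: "fps_deriv q = fps_const (- ?s) * q"
  proof (rule fps_deriv_expansion_eq[OF q])
    show "(\<lambda>w. - ?s * exp (- ?s * (?z0 + w))) has_fps_expansion fps_const (- ?s) * q"
      by (intro has_fps_expansion_mult has_fps_expansion_const q)
    show "\<forall>\<^sub>F w in nhds 0. ((\<lambda>w. exp (- ?s * (?z0 + w))) has_field_derivative - ?s * exp (- ?s * (?z0 + w))) (at w)"
      by (rule always_eventually, rule allI) (auto intro!: derivative_eq_intros)
  qed
  have B: "(\<lambda>w. Bc (?z0 + w)) has_fps_expansion fps_const (- ?p) * q"
    unfolding Bc_def by (intro has_fps_expansion_mult has_fps_expansion_const q)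
  obtain a c d e :: "complex fps" where
    conv: "\<forall>\<^sub>F z in nhds z0. (\<lambda>n. fps_nth a n * of_real ((z - z0) ^ n)) sums of_real (A z)"
    and a0: "fps_nth a 0 = of_real x0"
    and a': "fps_deriv a = fps_const (of_real (2 * besselK l \<omega>)) * (fps_deriv (fps_const (- ?p) * q) * (d * e))"
    and c: "a * c = 1" "fps_nth c 0 = of_real (1 / x0)"
    and d: "fps_deriv d = fps_deriv (fps_const ?s * (c + a)) * d"
      "fps_nth d 0 = of_real (exp (\<omega> * (1 / x0 + x0) / 2))"
    and e: "a * fps_deriv e = fps_const (of_real (1 - l)) * fps_deriv a * e"
      "fps_nth e 0 = of_real (x0 powr (1 - l))"
    by (rule gig_ivp_expansion[OF \<omega> Bc_an Bc_real B A0 A'])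
  have "complex_of_real (\<omega> * p_right l \<omega> * besselK l \<omega>) = of_real (2 * besselK l \<omega>) * (- ?p * - ?s)"
    by simp
  then have a'': "fps_deriv a = fps_const (of_real (\<omega> * p_right l \<omega> * besselK l \<omega>)) * (d * q * e)"
    unfolding a' by (simp only: q_eq fps_deriv_mult_const_left fps_const_mult[symmetric]) (simp only: ac_simps)
  have d': "fps_deriv (d * q) = fps_deriv (fps_const ?s * (c + a - fps_X)) * (d * q)"
    unfolding fps_deriv_mult d(1) q_eq
    by (simp add: algebra_simps fps_const_neg[symmetric] del: fps_const_neg)
  have "exp (- ?s * ?z0) = of_real (exp (- (\<omega> / 2) * z0))"
    by (simp flip: exp_of_real)
  then have "fps_nth q 0 = of_real (exp (- (\<omega> / 2) * z0))"
    using has_fps_expansion_imp_0_eq_fps_nth_0[OF q] by simp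
  then have d0: "fps_nth (d * q) 0 = of_real (exp (\<omega> / 2 * (1 / x0 + x0) - \<omega> * z0 / 2))"
    by (simp add: d(2) flip: of_real_mult exp_add)
  have "fps_nth a n = of_real (right_a l \<omega> z0 x0 n)" for n
    by (rule fps_nth_eq_right_a[OF A0(2) a0 a'' c d' d0 e])
  then show ?thesis
    using conv by (simp only: of_real_mult[symmetric] sums_of_real_iff)
qed

section \<open>Existence and uniqueness for the separable equation\<close>

context
  fixes l \<omega> u0 z0 x0 :: real and G :: "real \<Rightarrow> real \<Rightarrow> real" and B \<beta> :: "real \<Rightarrow> real"
  assumes \<omega>: "\<omega> > 0" and u0: "0 < u0" "u0 < 1"
    and B0: "B z0 = u0" and x0: "x0 = gig_quantile l \<omega> u0"
    and B': "\<forall>\<^sub>F z in nhds z0. (B has_real_derivative \<beta> z) (at z)"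
    and G: "\<forall>z. \<forall>y>0. G z y = \<beta> z / gig_pdf l \<omega> y"
begin

lemma gig_ivp_quantile_solution: "solves_ivp_near G z0 x0 (\<lambda>z. gig_quantile l \<omega> (B z))"
proof -
  have "isCont B z0" using eventually_nhds_x_imp_x[OF B'] DERIV_isCont by blast
  then have "(B \<longlongrightarrow> B z0) (nhds z0)" by (simp add: isCont_def tendsto_at_iff_tendsto_nhds)
  then have "\<forall>\<^sub>F z in nhds z0. B z \<in> {0<..<1}"
    using u0 B0 by (intro topological_tendstoD) auto
  then have "\<forall>\<^sub>F z in nhds z0. ((\<lambda>z. gig_quantile l \<omega> (B z)) has_real_derivative G z (gig_quantile l \<omega> (B z))) (at z)"
    using B'
  proof eventually_elim
    case (elim z)
    then have Bz: "0 < B z" "B z < 1" by auto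
    from DERIV_chain2[OF gig_quantile_has_derivative[OF \<omega> Bz, of l] elim(2)]
    show ?case unfolding G[rule_format, OF gig_quantile_pos[OF \<omega> Bz]] by (simp add: divide_inverse mult.commute)
  qed
  then show ?thesis by (simp add: solves_ivp_near_def B0 x0)
qed

text \<open>The separated form of the right-hand side is available for positive values only.
  Continuity at z0 and x0 > 0 keep A positive nearby.\<close>

lemma gig_ivp_separated:
  assumes A: "solves_ivp_near G z0 x0 A"
  shows "\<forall>\<^sub>F z in nhds z0. A z > 0 \<and> (A has_real_derivative \<beta> z / gig_pdf l \<omega> (A z)) (at z)"
proof -
  have A0: "A z0 = x0" and A': "\<forall>\<^sub>F z in nhds z0. (A has_real_derivative G z (A z)) (at z)"
    using A by (simp_all add: solves_ivp_near_def)
  have "isCont A z0" using eventually_nhds_x_imp_x[OF A'] DERIV_isCont by blast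
  then have "(A \<longlongrightarrow> A z0) (nhds z0)" by (simp add: isCont_def tendsto_at_iff_tendsto_nhds)
  then have "\<forall>\<^sub>F z in nhds z0. A z > 0"
    using gig_quantile_pos[OF \<omega> u0] by (intro order_tendstoD(1)) (auto simp: A0 x0)
  then show ?thesis using A' by eventually_elim (simp add: G)
qed

text \<open>F (A z) - B z has derivative 0 on a ball around z0 and vanishes at z0; inverting the
  distribution function then determines A on the whole ball.\<close>

lemma gig_ivp_solution_eq_quantile:
  assumes A: "solves_ivp_near G z0 x0 A"
  shows "\<forall>\<^sub>F z in nhds z0. A z = gig_quantile l \<omega> (B z)"
proof -
  obtain e where e: "e > 0" and loc: "\<And>z. dist z z0 < e \<Longrightarrow>
      A z > 0 \<and> (A has_real_derivative \<beta> z / gig_pdf l \<omega> (A z)) (at z) \<and> (B has_real_derivative \<beta> z) (at z)"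
    using eventually_conj[OF gig_ivp_separated[OF A] B'] unfolding eventually_nhds_metric by auto
  have "\<exists>c. \<forall>z\<in>ball z0 e. gig_cdf l \<omega> (A z) - B z = c"
  proof (rule has_field_derivative_zero_constant[OF convex_ball])
    fix z assume "z \<in> ball z0 e"
    then have z: "A z > 0" "(A has_real_derivative \<beta> z / gig_pdf l \<omega> (A z)) (at z)" "(B has_real_derivative \<beta> z) (at z)"
      using loc[of z] by (auto simp: dist_commute)
    have "((\<lambda>z. gig_cdf l \<omega> (A z) - B z) has_real_derivative
        gig_pdf l \<omega> (A z) * (\<beta> z / gig_pdf l \<omega> (A z)) - \<beta> z) (at z)"
      by (intro DERIV_diff DERIV_chain2[OF gig_cdf_has_derivative[OF \<omega> z(1)] z(2)] z(3))
    then have "((\<lambda>z. gig_cdf l \<omega> (A z) - B z) has_real_derivative 0) (at z)"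
      using gig_pdf_pos[OF \<omega> z(1), of l] by simp
    then show "((\<lambda>z. gig_cdf l \<omega> (A z) - B z) has_real_derivative 0) (at z within ball z0 e)"
      by (rule has_field_derivative_at_within)
  qed
  then obtain c where c: "\<And>z. z \<in> ball z0 e \<Longrightarrow> gig_cdf l \<omega> (A z) - B z = c" by blast
  have "A z0 = x0" using A by (simp add: solves_ivp_near_def)
  then have "c = 0" using c[of z0] e gig_cdf_quantile[OF \<omega> u0] by (simp add: B0 x0)
  show ?thesis
    unfolding eventually_nhds_metric
  proof (intro exI[of _ e] conjI e allI impI)
    fix z assume z: "dist z z0 < e"
    then have "gig_cdf l \<omega> (A z) = B z" using c[of z] \<open>c = 0\<close> by (simp add: dist_commute)
    then show "A z = gig_quantile l \<omega> (B z)"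
      using gig_quantile_cdf[OF \<omega>, of "A z" l] loc[OF z] by simp
  qed
qed

end

section \<open>The base quantile function and its behaviour at the mode\<close>

context
  fixes l \<omega> :: real
  assumes \<omega>: "\<omega> > 0"
begin

text \<open>This strict inequality keeps the logarithm in the left branch negative for all positive
  u up to and including p_m, so that the branch is positive and its denominator does not
  vanish.\<close>

lemma p_mode_less_p_left: "p_mode l \<omega> < p_left l \<omega>"
proof -
  have "1 < exp (\<omega> / (2 * gig_mode l \<omega>))" using \<omega> gig_mode_pos[OF \<omega>, of l] by simp
  then show ?thesis using p_mode_pos[OF \<omega>, of l] by (simp add: p_left_def)
qed

lemma base_quantile_left:
  assumes u: "0 < u" "u \<le> p_mode l \<omega>"
  shows "base_quantile l \<omega> u > 0" "p_left l \<omega> * exp (- (\<omega> / (2 * base_quantile l \<omega> u))) = u"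
proof -
  have p: "u < p_left l \<omega>" "0 < p_left l \<omega>" using p_mode_less_p_left u by linarith+
  then have "ln (u / p_left l \<omega>) < 0" using u by simp
  then show "base_quantile l \<omega> u > 0"
    using u \<omega> by (simp add: base_quantile_def divide_neg_pos divide_pos_neg)
  have "- (\<omega> / (2 * base_quantile l \<omega> u)) = ln (u / p_left l \<omega>)"
    using u \<omega> by (simp add: base_quantile_def)
  then show "p_left l \<omega> * exp (- (\<omega> / (2 * base_quantile l \<omega> u))) = u"
    using u p by simp
qed

text \<open>At p_m the definition takes the left branch. The exponential factor in
  \<open>p_left\<close> is chosen so that both branches have the value x_m there, so the right
  formula holds on the closed side.\<close>

lemma base_quantile_right_eq:
  assumes "p_mode l \<omega> \<le> u"
  shows "base_quantile l \<omega> u = gig_mode l \<omega> + 2 / \<omega> * ln ((p_mode l \<omega> - 1) / (u - 1))"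
proof (cases "u = p_mode l \<omega>")
  case True
  have "p_mode l \<omega> / p_left l \<omega> = exp (- (\<omega> / (2 * gig_mode l \<omega>)))"
    using p_mode_pos[OF \<omega>, of l] by (simp add: p_left_def exp_minus divide_simps)
  then have "ln (p_mode l \<omega> / p_left l \<omega>) = - (\<omega> / (2 * gig_mode l \<omega>))" by simp
  then show ?thesis
    using True p_mode_less_1[OF \<omega>, of l] \<omega> by (simp add: base_quantile_def)
qed (use assms in \<open>simp add: base_quantile_def\<close>)

lemma base_quantile_right:
  assumes u: "p_mode l \<omega> \<le> u" "u < 1"
  shows "1 - p_right l \<omega> * exp (- (\<omega> / 2 * base_quantile l \<omega> u)) = u"
proof -
  define q where "q = (p_mode l \<omega> - 1) / (u - 1)"
  have q: "q > 0" using p_mode_less_1[OF \<omega>, of l] u by (simp add: q_def divide_neg_neg)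
  have eq: "\<omega> / 2 * base_quantile l \<omega> u = \<omega> / 2 * gig_mode l \<omega> + ln q"
    using \<omega> by (simp add: base_quantile_right_eq[OF u(1)] q_def distrib_left)
  have "p_right l \<omega> * exp (- (\<omega> / 2 * base_quantile l \<omega> u)) = (1 - p_mode l \<omega>) / q"
    unfolding eq exp_minus exp_add exp_ln[OF q] p_right_def by (simp add: divide_simps)
  also have "\<dots> = 1 - u"
    using p_mode_less_1[OF \<omega>, of l] u by (simp add: q_def divide_simps) (simp add: algebra_simps)
  finally show ?thesis by simp
qed

text \<open>The left branch is continuous on both sides of u0, even for u0 = p_m, and so pulls the
  neighbourhood of z0 back. \<open>base_quantile\<close> coincides with it only for u \<le> p_m,
  hence the implication in the conclusion.\<close>

lemma eventually_base_quantile_left: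
  assumes u0: "0 < u0" "u0 \<le> p_mode l \<omega>" and P: "\<forall>\<^sub>F z in nhds (base_quantile l \<omega> u0). P z"
  shows "\<forall>\<^sub>F u in nhds u0. u \<le> p_mode l \<omega> \<longrightarrow> P (base_quantile l \<omega> u)"
proof -
  let ?L = "\<lambda>u. - (\<omega> / (2 * ln (u / p_left l \<omega>)))"
  have p: "u0 < p_left l \<omega>" "0 < p_left l \<omega>" using p_mode_less_p_left u0 by linarith+
  then have "ln (u0 / p_left l \<omega>) \<noteq> 0" using u0 by simp
  then have "isCont ?L u0" using p u0 by (intro continuous_intros) auto
  then have "(?L \<longlongrightarrow> ?L u0) (nhds u0)"
    unfolding isCont_def tendsto_at_iff_tendsto_nhds[of ?L] .
  moreover have "base_quantile l \<omega> u0 = ?L u0" using u0 by (simp add: base_quantile_def)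
  ultimately have "(?L \<longlongrightarrow> base_quantile l \<omega> u0) (nhds u0)" by (simp only:)
  from eventually_compose_filterlim[OF P this] show ?thesis
    by eventually_elim (simp add: base_quantile_def)
qed

lemma eventually_base_quantile_right:
  assumes u0: "p_mode l \<omega> \<le> u0" "u0 < 1" and P: "\<forall>\<^sub>F z in nhds (base_quantile l \<omega> u0). P z"
  shows "\<forall>\<^sub>F u in nhds u0. p_mode l \<omega> \<le> u \<longrightarrow> P (base_quantile l \<omega> u)"
proof -
  let ?R = "\<lambda>u. gig_mode l \<omega> + 2 / \<omega> * ln ((p_mode l \<omega> - 1) / (u - 1))"
  have "isCont ?R u0"
    using u0 p_mode_less_1[OF \<omega>, of l] \<omega> by (intro continuous_intros) auto
  then have "(?R \<longlongrightarrow> base_quantile l \<omega> u0) (nhds u0)"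
    unfolding base_quantile_right_eq[OF u0(1)] isCont_def tendsto_at_iff_tendsto_nhds[of ?R] .
  from eventually_compose_filterlim[OF P this] show ?thesis
    by eventually_elim (simp add: base_quantile_right_eq)
qed

lemma inverse_gig_pdf:
  assumes "y > 0"
  shows "1 / gig_pdf l \<omega> y = 2 * besselK l \<omega> * exp (1 / 2 * \<omega> * (1 / y + y)) * y powr (1 - l)"
proof -
  have "y powr (1 - l) = 1 / y powr (l - 1)"
    using powr_minus_divide[of y "l - 1"] by simp
  moreover have "exp (- (\<omega> / 2) * (1 / y + y)) = 1 / exp (1 / 2 * \<omega> * (1 / y + y))"
    by (simp add: exp_minus inverse_eq_divide)
  ultimately show ?thesis by (simp add: gig_pdf_def)
qed

lemma left_rhs_eq:
  assumes "y > 0"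
  shows "left_rhs l \<omega> z y = p_left l \<omega> * (\<omega> / (2 * z\<^sup>2)) * exp (- (\<omega> / (2 * z))) / gig_pdf l \<omega> y"
proof -
  have "b / gig_pdf l \<omega> y = b * (1 / gig_pdf l \<omega> y)" for b by simp
  then show ?thesis
    unfolding inverse_gig_pdf[OF assms] left_rhs_def by (simp only: ac_simps)
qed

lemma right_rhs_eq:
  assumes "y > 0"
  shows "right_rhs l \<omega> z y = p_right l \<omega> * (\<omega> / 2) * exp (- (\<omega> / 2 * z)) / gig_pdf l \<omega> y"
proof -
  have "exp (1 / 2 * \<omega> * (1 / y + y - z)) = exp (- (\<omega> / 2 * z)) * exp (1 / 2 * \<omega> * (1 / y + y))"
    unfolding exp_add[symmetric] by (simp add: algebra_simps)
  moreover have "b / gig_pdf l \<omega> y = b * (1 / gig_pdf l \<omega> y)" for b by simp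
  ultimately show ?thesis
    unfolding inverse_gig_pdf[OF assms] right_rhs_def by simp
qed

text \<open>The function \<open>?B\<close> is the left formula of the base distribution function on
  a full neighbourhood of z0, also beyond the mode. It inverts \<open>base_quantile\<close> only for
  u \<le> p_m, which is where the one-sided conclusion comes from.\<close>

lemma left_problem:
  assumes u0: "0 < u0" "u0 \<le> p_mode l \<omega>"
    and z0: "z0 = base_quantile l \<omega> u0" and x0: "x0 = gig_quantile l \<omega> u0"
  shows "\<exists>A. solves_ivp_near (left_rhs l \<omega>) z0 x0 A"
    and "solves_ivp_near (left_rhs l \<omega>) z0 x0 A \<Longrightarrow>
      \<forall>\<^sub>F z in nhds z0. (\<lambda>n. left_a l \<omega> z0 x0 n * (z - z0) ^ n) sums A z"
    and "solves_ivp_near (left_rhs l \<omega>) z0 x0 A \<Longrightarrow>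
      \<forall>\<^sub>F u in nhds u0. u \<le> p_mode l \<omega> \<longrightarrow> gig_quantile l \<omega> u = A (base_quantile l \<omega> u)"
proof -
  let ?B = "\<lambda>z. p_left l \<omega> * exp (- (\<omega> / (2 * z)))"
  let ?\<beta> = "\<lambda>z. p_left l \<omega> * (\<omega> / (2 * z\<^sup>2)) * exp (- (\<omega> / (2 * z)))"
  have u1: "u0 < 1" using u0 p_mode_less_1[OF \<omega>, of l] by linarith
  have z0_pos: "z0 > 0" and B0: "?B z0 = u0"
    using base_quantile_left[OF u0] by (simp_all add: z0)
  have "\<forall>\<^sub>F z in nhds z0. z \<in> {0<..}" using z0_pos by (intro eventually_nhds_in_open) auto
  then have B': "\<forall>\<^sub>F z in nhds z0. (?B has_real_derivative ?\<beta> z) (at z)"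
    by eventually_elim (auto intro!: derivative_eq_intros simp: power2_eq_square)
  have G: "\<forall>z. \<forall>y>0. left_rhs l \<omega> z y = ?\<beta> z / gig_pdf l \<omega> y" by (intro allI impI left_rhs_eq)
  note ivp = \<omega> u0(1) u1 B0 x0 B' G
  show "\<exists>A. solves_ivp_near (left_rhs l \<omega>) z0 x0 A"
    using gig_ivp_quantile_solution[OF ivp] by blast
  assume A: "solves_ivp_near (left_rhs l \<omega>) z0 x0 A"
  have x0_pos: "x0 > 0" using gig_quantile_pos[OF \<omega> u0(1) u1] by (simp add: x0)
  show "\<forall>\<^sub>F z in nhds z0. (\<lambda>n. left_a l \<omega> z0 x0 n * (z - z0) ^ n) sums A z"
  proof (rule left_series_expansion[OF \<omega> z0_pos _ x0_pos])
    show "A z0 = x0" using A by (simp add: solves_ivp_near_def)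
    show "\<forall>\<^sub>F z in nhds z0. (A has_real_derivative ?\<beta> z / gig_pdf l \<omega> (A z)) (at z)"
      using gig_ivp_separated[OF ivp A] by (rule eventually_mono) (elim conjunct2)
  qed
  have "\<forall>\<^sub>F z in nhds (base_quantile l \<omega> u0). A z = gig_quantile l \<omega> (?B z)"
    using gig_ivp_solution_eq_quantile[OF ivp A] by (simp only: z0)
  then have "\<forall>\<^sub>F u in nhds u0. u \<le> p_mode l \<omega> \<longrightarrow>
      A (base_quantile l \<omega> u) = gig_quantile l \<omega> (?B (base_quantile l \<omega> u))"
    by (rule eventually_base_quantile_left[OF u0])
  \<comment> \<open>Besides u \<le> p_m, the inversion of the left branch requires u > 0, which
    holds near u0.\<close>
  moreover have "\<forall>\<^sub>F u in nhds u0. u \<in> {0<..}" using u0 by (intro eventually_nhds_in_open) auto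
  ultimately show "\<forall>\<^sub>F u in nhds u0. u \<le> p_mode l \<omega> \<longrightarrow> gig_quantile l \<omega> u = A (base_quantile l \<omega> u)"
    by eventually_elim (simp add: base_quantile_left(2))
qed

lemma right_problem:
  assumes u0: "p_mode l \<omega> \<le> u0" "u0 < 1"
    and z0: "z0 = base_quantile l \<omega> u0" and x0: "x0 = gig_quantile l \<omega> u0"
  shows "\<exists>A. solves_ivp_near (right_rhs l \<omega>) z0 x0 A"
    and "solves_ivp_near (right_rhs l \<omega>) z0 x0 A \<Longrightarrow>
      \<forall>\<^sub>F z in nhds z0. (\<lambda>n. right_a l \<omega> z0 x0 n * (z - z0) ^ n) sums A z"
    and "solves_ivp_near (right_rhs l \<omega>) z0 x0 A \<Longrightarrow>
      \<forall>\<^sub>F u in nhds u0. p_mode l \<omega> \<le> u \<longrightarrow> gig_quantile l \<omega> u = A (base_quantile l \<omega> u)"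
proof -
  let ?B = "\<lambda>z. 1 - p_right l \<omega> * exp (- (\<omega> / 2 * z))"
  let ?\<beta> = "\<lambda>z. p_right l \<omega> * (\<omega> / 2) * exp (- (\<omega> / 2 * z))"
  have u0_pos: "0 < u0" using u0 p_mode_pos[OF \<omega>, of l] by linarith
  have B0: "?B z0 = u0"
    using base_quantile_right[OF u0] by (simp add: z0)
  have B': "\<forall>\<^sub>F z in nhds z0. (?B has_real_derivative ?\<beta> z) (at z)"
    by (rule always_eventually, rule allI) (auto intro!: derivative_eq_intros)
  have G: "\<forall>z. \<forall>y>0. right_rhs l \<omega> z y = ?\<beta> z / gig_pdf l \<omega> y" by (intro allI impI right_rhs_eq)
  note ivp = \<omega> u0_pos u0(2) B0 x0 B' G
  show "\<exists>A. solves_ivp_near (right_rhs l \<omega>) z0 x0 A"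
    using gig_ivp_quantile_solution[OF ivp] by blast
  assume A: "solves_ivp_near (right_rhs l \<omega>) z0 x0 A"
  have x0_pos: "x0 > 0" using gig_quantile_pos[OF \<omega> u0_pos u0(2)] by (simp add: x0)
  show "\<forall>\<^sub>F z in nhds z0. (\<lambda>n. right_a l \<omega> z0 x0 n * (z - z0) ^ n) sums A z"
  proof (rule right_series_expansion[OF \<omega> _ x0_pos])
    show "A z0 = x0" using A by (simp add: solves_ivp_near_def)
    show "\<forall>\<^sub>F z in nhds z0. (A has_real_derivative ?\<beta> z / gig_pdf l \<omega> (A z)) (at z)"
      using gig_ivp_separated[OF ivp A] by (rule eventually_mono) (elim conjunct2)
  qed
  have "\<forall>\<^sub>F z in nhds (base_quantile l \<omega> u0). A z = gig_quantile l \<omega> (?B z)"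
    using gig_ivp_solution_eq_quantile[OF ivp A] by (simp only: z0)
  then have "\<forall>\<^sub>F u in nhds u0. p_mode l \<omega> \<le> u \<longrightarrow>
      A (base_quantile l \<omega> u) = gig_quantile l \<omega> (?B (base_quantile l \<omega> u))"
    by (rule eventually_base_quantile_right[OF u0])
  moreover have "\<forall>\<^sub>F u in nhds u0. u \<in> {..<1}" using u0 by (intro eventually_nhds_in_open) auto
  ultimately show "\<forall>\<^sub>F u in nhds u0. p_mode l \<omega> \<le> u \<longrightarrow> gig_quantile l \<omega> u = A (base_quantile l \<omega> u)"
    by eventually_elim (metis base_quantile_right lessThan_iff)
qed

end

theorem mainTheorem9:
  fixes l \<omega> :: real
  assumes "\<omega> > 0"
  shows "(\<forall>u0. 0 < u0 \<and> u0 \<le> p_mode l \<omega> \<longrightarrow>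
           (let z0 = base_quantile l \<omega> u0; x0 = gig_quantile l \<omega> u0 in
             (\<exists>A. solves_ivp_near (left_rhs l \<omega>) z0 x0 A) \<and>
             (\<forall>A. solves_ivp_near (left_rhs l \<omega>) z0 x0 A \<longrightarrow>
               (\<forall>\<^sub>F z in nhds z0. (\<lambda>n. left_a l \<omega> z0 x0 n * (z - z0) ^ n) sums A z) \<and>
               (\<forall>\<^sub>F u in nhds u0. u \<le> p_mode l \<omega> \<longrightarrow>
                   gig_quantile l \<omega> u = A (base_quantile l \<omega> u)))))
       \<and> (\<forall>u0. p_mode l \<omega> \<le> u0 \<and> u0 < 1 \<longrightarrow>
           (let z0 = base_quantile l \<omega> u0; x0 = gig_quantile l \<omega> u0 in
             (\<exists>A. solves_ivp_near (right_rhs l \<omega>) z0 x0 A) \<and>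
             (\<forall>A. solves_ivp_near (right_rhs l \<omega>) z0 x0 A \<longrightarrow>
               (\<forall>\<^sub>F z in nhds z0. (\<lambda>n. right_a l \<omega> z0 x0 n * (z - z0) ^ n) sums A z) \<and>
               (\<forall>\<^sub>F u in nhds u0. p_mode l \<omega> \<le> u \<longrightarrow>
                   gig_quantile l \<omega> u = A (base_quantile l \<omega> u)))))"
  unfolding Let_def
  by (intro conjI allI impI; elim conjE; rule left_problem right_problem; (rule assms refl | assumption)+)

end
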